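(* Let $k\geq 3$ be an integer, let $\{s_i\}_{i=1}^{k^2}$ be an enumerated basis of the space $\mathcal{L}_k$ of theta functions of degree $k$ on the Kodaira--Thurston manifold $M_{KT}=\mathbb{R}^4/\Gamma$, and let $$\varphi_k: M_{KT}\to\mathbb{CP}^{k^2-1},\qquad \varphi_k([u]) = [s_1(u):s_2(u):\ldots:s_{k^2}(u)],\quad u=(x,y,z,t)\in\mathbb{R}^4 .$$ Then the map $\varphi_k$ is an embedding of smooth manifolds (that is, it is a well-defined smooth injective immersion of the compact manifold $M_{KT}$ into $\mathbb{CP}^{k^2-1}$).
   Context: The Kodaira--Thurston manifold $M_{KT}$ is the quotient of $\mathbb{R}^4$, with coordinates $(x,y,z,t)$, by the free action of the discrete group $\Gamma$ generated by the diffeomorphisms $$a:(x,y,z,t)\mapsto(x+1,y,z+y,t),\quad b:(x,y,z,t)\mapsto(x,y+1,z,t),$$ $$c:(x,y,z,t)\mapsto(x,y,z+1,t),\quad d:(x,y,z,t)\mapsto(x,y,z,t+1).$$ It is a compact smooth 4-manifold. Classical theta functions: for $\tau\in\mathbb{C}$ with $\mathrm{Im}\,\tau>0$ and $k\in\mathbb{N}$, a classical theta function of degree $k$ is an entire function $w\mapsto\theta_k(w,\tau)$ satisfying $$\theta_k(w+1,\tau)=\theta_k(w,\tau),\qquad \theta_k(w+\tau,\tau)=\exp(-2\pi i k w)\,\theta_k(w,\tau).$$ For fixed $\tau$ these form a complex vector space of dimension $k$. Fix a family $\{\theta_k^p(w,\tau)\}_{p=1}^k$ of functions, holomorphic in $(w,\tau)\in\mathbb{C}\times\{\mathrm{Im}\,\tau>0\}$,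 such that for every $\tau$ the functions $\theta_k^1(\cdot,\tau),\ldots,\theta_k^k(\cdot,\tau)$ form a basis of this space, and such that $\theta_k^p(w,\tau+1)=\theta_k^p(w,\tau)$ for all $p$. (Such families exist, for example $\theta_k^p(w,\tau)=\sum_{m\in\mathbb{Z}}e^{2\pi i(p+km)w+\pi i(2pm+km(m-1))\tau}$.) Theta functions on $M_{KT}$: the space $\mathcal{L}_k$ of theta functions of degree $k$ on $M_{KT}$ is the complex linear span of the $k^2$ functions on $\mathbb{R}^4$ $$(x,y,z,t)\mapsto\theta_k^p(z+ix,\,y+i)\cdot\theta_k^q(y+it,\,i),\qquad p,q=1,\ldots,k.$$ It has dimension $k^2$. Its elements are sections of a complex line bundle over $M_{KT}$: all $s\in\mathcal{L}_k$ transform under each generator of $\Gamma$ by the same nowhere vanishing factor. *)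

theory Defs
  imports
    "HOL-Analysis.Analysis"
    "HOL-Algebra.Bij"
    "HOL-Algebra.Generated_Groups"
    "HOL-Library.Function_Algebras"
begin

section \<open>Smooth maps between manifolds\<close>

primrec n_times_differentiable_on ::
  "nat \<Rightarrow> 'a::real_normed_vector set \<Rightarrow> ('a \<Rightarrow> 'b::real_normed_vector) \<Rightarrow> bool"
where
  "n_times_differentiable_on 0 S f \<longleftrightarrow> continuous_on S f"
| "n_times_differentiable_on (Suc n) S f \<longleftrightarrow>
     (\<forall>x\<in>S. f differentiable (at x)) \<and>
     (\<forall>v. n_times_differentiable_on n S (\<lambda>x. frechet_derivative f (at x) v))"

text \<open>Only used on open sets \<open>S\<close>.\<close>
definition smooth_on :: "'a::real_normed_vector set \<Rightarrow> ('a \<Rightarrow> 'b::real_normed_vector) \<Rightarrow> bool"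
  where "smooth_on S f \<longleftrightarrow> (\<forall>n. n_times_differentiable_on n S f)"

text \<open>A chart is a pair of its domain and the coordinate map; only the values of the coordinate
  map on the domain matter.\<close>
type_synonym ('a, 'e) chart = "'a set \<times> ('a \<Rightarrow> 'e)"

definition smooth_atlas :: "'a topology \<Rightarrow> ('a, 'e::euclidean_space) chart set \<Rightarrow> bool"
  where "smooth_atlas X A \<longleftrightarrow>
    (\<Union>(D, \<phi>)\<in>A. D) = topspace X \<and>
    (\<forall>(D, \<phi>)\<in>A. openin X D \<and> open (\<phi> ` D) \<and>
       homeomorphic_map (subtopology X D) (top_of_set (\<phi> ` D)) \<phi>) \<and>
    (\<forall>(D, \<phi>)\<in>A. \<forall>(E, \<psi>)\<in>A. smooth_on (\<phi> ` (D \<inter> E)) (\<psi> \<circ> inv_into D \<phi>))"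

definition smooth_map ::
  "'a topology \<Rightarrow> ('a, 'e::euclidean_space) chart set \<Rightarrow>
   'b topology \<Rightarrow> ('b, 'f::euclidean_space) chart set \<Rightarrow> ('a \<Rightarrow> 'b) \<Rightarrow> bool"
  where "smooth_map X A Y B f \<longleftrightarrow>
    continuous_map X Y f \<and>
    (\<forall>(D, \<phi>)\<in>A. \<forall>(E, \<psi>)\<in>B. smooth_on (\<phi> ` (D \<inter> f -` E)) (\<psi> \<circ> f \<circ> inv_into D \<phi>))"

definition immersion ::
  "'a topology \<Rightarrow> ('a, 'e::euclidean_space) chart set \<Rightarrow>
   'b topology \<Rightarrow> ('b, 'f::euclidean_space) chart set \<Rightarrow> ('a \<Rightarrow> 'b) \<Rightarrow> bool"
  where "immersion X A Y B f \<longleftrightarrow>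
    smooth_map X A Y B f \<and>
    (\<forall>(D, \<phi>)\<in>A. \<forall>(E, \<psi>)\<in>B. \<forall>x \<in> D \<inter> f -` E.
       inj (frechet_derivative (\<psi> \<circ> f \<circ> inv_into D \<phi>) (at (\<phi> x))))"

text \<open>\<^const>\<open>embedding_map\<close> means homeomorphism onto the image. It already implies injectivity, and
  follows from continuity and injectivity if \<open>X\<close> is compact and \<open>Y\<close> is Hausdorff.\<close>
definition smooth_embedding ::
  "'a topology \<Rightarrow> ('a, 'e::euclidean_space) chart set \<Rightarrow>
   'b topology \<Rightarrow> ('b, 'f::euclidean_space) chart set \<Rightarrow> ('a \<Rightarrow> 'b) \<Rightarrow> bool"
  where "smooth_embedding X A Y B f \<longleftrightarrow>
    immersion X A Y B f \<and> inj_on f (topspace X) \<and> embedding_map X Y f"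

definition quotient_topology :: "'a::topological_space set \<Rightarrow> ('a \<Rightarrow> 'b) \<Rightarrow> 'b topology"
  where "quotient_topology S p =
    topology (\<lambda>U. U \<subseteq> p ` S \<and> openin (top_of_set S) (S \<inter> p -` U))"


section \<open>The Kodaira--Thurston manifold\<close>

type_synonym r4 = "real \<times> real \<times> real \<times> real"

definition kt_a :: "r4 \<Rightarrow> r4" where "kt_a = (\<lambda>(x, y, z, t). (x + 1, y, z + y, t))"
definition kt_b :: "r4 \<Rightarrow> r4" where "kt_b = (\<lambda>(x, y, z, t). (x, y + 1, z, t))"
definition kt_c :: "r4 \<Rightarrow> r4" where "kt_c = (\<lambda>(x, y, z, t). (x, y, z + 1, t))"
definition kt_d :: "r4 \<Rightarrow> r4" where "kt_d = (\<lambda>(x, y, z, t). (x, y, z, t + 1))"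

definition kt_group :: "(r4 \<Rightarrow> r4) set"
  where "kt_group = generate (BijGroup UNIV) {kt_a, kt_b, kt_c, kt_d}"

text \<open>Points of the quotient are orbits; this is the quotient projection.\<close>
definition kt_proj :: "r4 \<Rightarrow> r4 set"
  where "kt_proj u = (\<lambda>g. g u) ` kt_group"

definition kt_top :: "r4 set topology"
  where "kt_top = quotient_topology UNIV kt_proj"

text \<open>The charts are the local inverses of the projection.\<close>
definition kt_atlas :: "(r4 set, r4) chart set"
  where "kt_atlas = {(kt_proj ` V, inv_into V kt_proj) | V. open V \<and> inj_on kt_proj V}"


section \<open>Complex projective space\<close>

text \<open>The \<open>CARD('m)\<close>-dimensional projective space has its homogeneous coordinates indexed by
  \<^typ>\<open>'m option\<close>, so that the affine charts take values in \<^typ>\<open>complex ^ 'm\<close>.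
  \<open>cp_point z\<close> is the point with homogeneous coordinates \<open>z\<close>, as a punctured complex line;
  it is a point of projective space only for \<open>z \<noteq> 0\<close>.\<close>
definition cp_point :: "complex ^ 'm::finite option \<Rightarrow> (complex ^ 'm option) set"
  where "cp_point z = {c *s z | c. c \<noteq> 0}"

definition cp_top :: "(complex ^ 'm::finite option) set topology"
  where "cp_top = quotient_topology (UNIV - {0}) cp_point"

text \<open>For each \<open>j\<close>, a bijection from \<^typ>\<open>'m\<close> to the indices different from \<open>j\<close>.\<close>
definition cp_index :: "'m option \<Rightarrow> 'm \<Rightarrow> 'm option"
  where "cp_index j i = (if Some i = j then None else Some i)"

text \<open>The affine chart \<open>[z] \<mapsto> (z\<^sub>i / z\<^sub>j)\<close>, \<open>i \<noteq> j\<close>; the quotients do not depend on the representative.\<close>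
definition cp_chart :: "'m::finite option \<Rightarrow> (complex ^ 'm option) set \<Rightarrow> complex ^ 'm"
  where "cp_chart j L = (let z = (SOME z. z \<in> L) in (\<chi> i. z $ cp_index j i / z $ j))"

definition cp_atlas :: "((complex ^ 'm::finite option) set, complex ^ 'm) chart set"
  where "cp_atlas = {(cp_point ` {z. z $ j \<noteq> 0}, cp_chart j) | j. True}"


section \<open>Theta functions\<close>

definition cfun_scale :: "complex \<Rightarrow> ('a \<Rightarrow> complex) \<Rightarrow> ('a \<Rightarrow> complex)"
  where "cfun_scale c f = (\<lambda>x. c * f x)"

interpretation cfun: vector_space cfun_scale
  by unfold_locales (simp_all add: cfun_scale_def fun_eq_iff algebra_simps)

definition is_basis :: "'i set \<Rightarrow> ('i \<Rightarrow> 'a \<Rightarrow> complex) \<Rightarrow> ('a \<Rightarrow> complex) set \<Rightarrow> bool"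
  where "is_basis I b V \<longleftrightarrow>
    inj_on b I \<and> \<not> cfun.dependent (b ` I) \<and> cfun.span (b ` I) = V"

definition classical_theta :: "nat \<Rightarrow> complex \<Rightarrow> (complex \<Rightarrow> complex) set"
  where "classical_theta k \<tau> = {f. f holomorphic_on UNIV \<and>
    (\<forall>w. f (w + 1) = f w \<and> f (w + \<tau>) = exp (- 2 * of_real pi * \<i> * of_nat k * w) * f w)}"

text \<open>Joint holomorphy in two variables on an open set: the Frechet derivative exists and is
  complex linear.\<close>
definition holomorphic2_on :: "(complex \<times> complex \<Rightarrow> complex) \<Rightarrow> (complex \<times> complex) set \<Rightarrow> bool"
  where "holomorphic2_on F S \<longleftrightarrow>
    (\<forall>p\<in>S. \<exists>\<alpha> \<beta>. (F has_derivative (\<lambda>(u, v). \<alpha> * u + \<beta> * v)) (at p))"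

text \<open>\<open>\<theta> p w \<tau>\<close> is the \<open>p\<close>-th member of the family, for \<open>p = 1, \<dots>, k\<close>.\<close>
definition theta_family :: "nat \<Rightarrow> (nat \<Rightarrow> complex \<Rightarrow> complex \<Rightarrow> complex) \<Rightarrow> bool"
  where "theta_family k \<theta> \<longleftrightarrow>
    (\<forall>p\<in>{1..k}. holomorphic2_on (\<lambda>(w, \<tau>). \<theta> p w \<tau>) {(w, \<tau>). Im \<tau> > 0}) \<and>
    (\<forall>\<tau>. Im \<tau> > 0 \<longrightarrow> is_basis {1..k} (\<lambda>p w. \<theta> p w \<tau>) (classical_theta k \<tau>)) \<and>
    (\<forall>p\<in>{1..k}. \<forall>w \<tau>. Im \<tau> > 0 \<longrightarrow> \<theta> p w (\<tau> + 1) = \<theta> p w \<tau>)"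

definition kt_theta ::
  "(nat \<Rightarrow> complex \<Rightarrow> complex \<Rightarrow> complex) \<Rightarrow> nat \<Rightarrow> nat \<Rightarrow> r4 \<Rightarrow> complex"
  where "kt_theta \<theta> p q = (\<lambda>(x, y, z, t).
    \<theta> p (of_real z + \<i> * of_real x) (of_real y + \<i>) * \<theta> q (of_real y + \<i> * of_real t) \<i>)"

definition kt_theta_space ::
  "nat \<Rightarrow> (nat \<Rightarrow> complex \<Rightarrow> complex \<Rightarrow> complex) \<Rightarrow> (r4 \<Rightarrow> complex) set"
  where "kt_theta_space k \<theta> = cfun.span {kt_theta \<theta> p q | p q. p \<in> {1..k} \<and> q \<in> {1..k}}"


section \<open>The two atlases are smooth atlases\<close>

lemma openin_quotient_topology:
  "openin (quotient_topology S p) U \<longleftrightarrow> U \<subseteq> p ` S \<and> openin (top_of_set S) (S \<inter> p -` U)"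
proof -
  have "istopology (\<lambda>U. U \<subseteq> p ` S \<and> openin (top_of_set S) (S \<inter> p -` U))"
    unfolding istopology_def
  proof safe
    fix U V assume "openin (top_of_set S) (S \<inter> p -` U)" "openin (top_of_set S) (S \<inter> p -` V)"
    then have "openin (top_of_set S) ((S \<inter> p -` U) \<inter> (S \<inter> p -` V))" by (rule openin_Int)
    moreover have "(S \<inter> p -` U) \<inter> (S \<inter> p -` V) = S \<inter> p -` (U \<inter> V)" by auto
    ultimately show "openin (top_of_set S) (S \<inter> p -` (U \<inter> V))" by simp
  next
    fix K assume "\<forall>U\<in>K. U \<subseteq> p ` S \<and> openin (top_of_set S) (S \<inter> p -` U)"
    then have "openin (top_of_set S) (\<Union>U\<in>K. S \<inter> p -` U)" by (intro openin_Union) auto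
    moreover have "(\<Union>U\<in>K. S \<inter> p -` U) = S \<inter> p -` \<Union>K" by auto
    ultimately show "openin (top_of_set S) (S \<inter> p -` \<Union>K)" by simp
  qed auto
  then show ?thesis by (simp add: quotient_topology_def topology_inverse')
qed

lemma topspace_quotient_topology [simp]: "topspace (quotient_topology S p) = p ` S"
proof -
  have "openin (quotient_topology S p) (p ` S)"
  proof -
    have "S \<inter> p -` p ` S = S" by auto
    then show ?thesis by (simp add: openin_quotient_topology)
  qed
  then show ?thesis
    using openin_quotient_topology openin_subset openin_topspace by (metis subset_antisym)
qed

lemma quotient_map_quotient_topology: "quotient_map (top_of_set S) (quotient_topology S p) p"
proof -
  have "{x \<in> S. p x \<in> U} = S \<inter> p -` U" for U by blast
  then show ?thesis by (simp add: quotient_map_def openin_quotient_topology)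
qed

lemma n_times_differentiable_on_cong:
  "open S \<Longrightarrow> (\<And>x. x \<in> S \<Longrightarrow> f x = g x) \<Longrightarrow>
    n_times_differentiable_on n S f \<Longrightarrow> n_times_differentiable_on n S g"
proof (induction n arbitrary: f g)
  case 0 then show ?case by (simp cong: continuous_on_cong)
next
  case (Suc n)
  have *: "(g has_derivative frechet_derivative f (at x)) (at x)" if "x \<in> S" for x
    by (rule has_derivative_transform_within_open[where s=S and f=f])
      (use that Suc.prems in \<open>auto simp: frechet_derivative_works\<close>)
  have eq: "frechet_derivative g (at x) = frechet_derivative f (at x)" if "x \<in> S" for x
    using *[OF that] frechet_derivative_at by metis
  show ?case
    using * Suc.IH[of "\<lambda>x. frechet_derivative f (at x) v" "\<lambda>x. frechet_derivative g (at x) v" for v]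
      Suc.prems eq
    by (auto simp: differentiable_def)
qed

lemma n_times_differentiable_on_local:
  "open S \<Longrightarrow> (\<And>x. x \<in> S \<Longrightarrow> \<exists>T. open T \<and> x \<in> T \<and> n_times_differentiable_on n T f) \<Longrightarrow>
    n_times_differentiable_on n S f"
proof (induction n arbitrary: f)
  case 0 
  then show ?case
    by (metis at_within_open continuous_at_imp_continuous_on continuous_on_eq_continuous_within n_times_differentiable_on.simps(1))
next
  case (Suc n)
  show ?case unfolding n_times_differentiable_on.simps
  proof (intro conjI ballI allI)
    fix x assume "x \<in> S"
    with Suc.prems(2) show "f differentiable (at x)" by (meson n_times_differentiable_on.simps(2))
  next
    fix v show "n_times_differentiable_on n S (\<lambda>x. frechet_derivative f (at x) v)"
    proof (rule Suc.IH[OF Suc.prems(1)])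
      fix x assume "x \<in> S"
      from Suc.prems(2)[OF this] obtain T
        where "open T" "x \<in> T" "n_times_differentiable_on (Suc n) T f" by blast
      then show "\<exists>T. open T \<and> x \<in> T \<and>
          n_times_differentiable_on n T (\<lambda>x. frechet_derivative f (at x) v)" by auto
    qed
  qed
qed

lemma n_times_differentiable_on_subset:
  "T \<subseteq> S \<Longrightarrow> n_times_differentiable_on n S f \<Longrightarrow> n_times_differentiable_on n T f"
proof (induction n arbitrary: f)
  case 0 then show ?case by (simp add: continuous_on_subset)
next
  case (Suc n) then show ?case unfolding n_times_differentiable_on.simps(2) by blast
qed

lemma n_times_differentiable_on_const: "n_times_differentiable_on n S (\<lambda>x. c)"
proof (induction n arbitrary: c)
  case (Suc n) then show ?case by simp
qed simp

lemma n_times_differentiable_on_affine: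
  assumes "bounded_linear A"
  shows "n_times_differentiable_on n S (\<lambda>x. A x + c)"
proof (cases n)
  case 0 then show ?thesis using assms
    by (auto intro: continuous_on_add[OF linear_continuous_on[OF assms] continuous_on_const])
next
  case (Suc m)
  have "((\<lambda>x. A x + c) has_derivative A) (at x)" for x
    using has_derivative_add_const[OF bounded_linear_imp_has_derivative[OF assms]] .
  then have "frechet_derivative (\<lambda>x. A x + c) (at x) = A" "(\<lambda>x. A x + c) differentiable (at x)" for x
    using frechet_derivative_at by (metis, auto simp: differentiable_def)
  then show ?thesis by (simp add: Suc n_times_differentiable_on_const)
qed

lemma n_times_differentiable_on_Suc_D:
  "n_times_differentiable_on (Suc n) S f \<Longrightarrow> n_times_differentiable_on n S f"
proof (induction n arbitrary: f)
  case 0 then show ?case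
    by (auto intro!: differentiable_imp_continuous_on simp: differentiable_on_def differentiable_at_withinI)
next
  case (Suc n)
  show ?case unfolding n_times_differentiable_on.simps(2)[of n]
    using Suc.prems Suc.IH unfolding n_times_differentiable_on.simps(2)[of "Suc n"] by blast
qed

lemma n_times_differentiable_on_add:
  "open S \<Longrightarrow> n_times_differentiable_on n S f \<Longrightarrow> n_times_differentiable_on n S g \<Longrightarrow>
   n_times_differentiable_on n S (\<lambda>x. f x + g x)"
proof (induction n arbitrary: f g)
  case 0 then show ?case by (auto intro: continuous_intros)
next
  case (Suc n)
  have *: "((\<lambda>x. f x + g x) has_derivative
      (\<lambda>v. frechet_derivative f (at x) v + frechet_derivative g (at x) v)) (at x)" if "x \<in> S" for x
    using Suc.prems that by (auto intro!: has_derivative_add simp: frechet_derivative_works)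
  have eq: "frechet_derivative (\<lambda>x. f x + g x) (at x) =
      (\<lambda>v. frechet_derivative f (at x) v + frechet_derivative g (at x) v)" if "x \<in> S" for x
    using frechet_derivative_at[OF *[OF that]] by simp
  have "n_times_differentiable_on n S (\<lambda>x. frechet_derivative (\<lambda>x. f x + g x) (at x) v)" for v
    by (rule n_times_differentiable_on_cong[OF \<open>open S\<close> _ Suc.IH[of "\<lambda>x. frechet_derivative f (at x) v" "\<lambda>x. frechet_derivative g (at x) v"]])
      (use Suc.prems eq in auto)
  then show ?case using * by (auto simp: differentiable_def)
qed

lemma n_times_differentiable_on_mult:
  fixes f g :: "'a::real_normed_vector \<Rightarrow> complex"
  shows "open S \<Longrightarrow> n_times_differentiable_on n S f \<Longrightarrow> n_times_differentiable_on n S g \<Longrightarrow>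
   n_times_differentiable_on n S (\<lambda>x. f x * g x)"
proof (induction n arbitrary: f g)
  case 0 then show ?case by (auto intro: continuous_intros)
next
  case (Suc n)
  have *: "((\<lambda>x. f x * g x) has_derivative
      (\<lambda>v. f x * frechet_derivative g (at x) v + frechet_derivative f (at x) v * g x)) (at x)"
      if "x \<in> S" for x
    using Suc.prems that by (auto intro!: has_derivative_mult simp: frechet_derivative_works)
  have eq: "frechet_derivative (\<lambda>x. f x * g x) (at x) =
      (\<lambda>v. f x * frechet_derivative g (at x) v + frechet_derivative f (at x) v * g x)" if "x \<in> S" for x
    using frechet_derivative_at[OF *[OF that]] by simp
  have "n_times_differentiable_on n S
      (\<lambda>x. f x * frechet_derivative g (at x) v + frechet_derivative f (at x) v * g x)" for v
    using Suc.prems n_times_differentiable_on_Suc_D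
    by (auto intro!: n_times_differentiable_on_add Suc.IH)
  then have "n_times_differentiable_on n S (\<lambda>x. frechet_derivative (\<lambda>x. f x * g x) (at x) v)" for v
    by (rule n_times_differentiable_on_cong[OF \<open>open S\<close>, rotated]) (use eq in auto)
  then show ?case using * by (auto simp: differentiable_def)
qed

lemma n_times_differentiable_on_inverse:
  fixes f :: "'a::real_normed_vector \<Rightarrow> complex"
  shows "open S \<Longrightarrow> n_times_differentiable_on n S f \<Longrightarrow> (\<And>x. x \<in> S \<Longrightarrow> f x \<noteq> 0) \<Longrightarrow>
   n_times_differentiable_on n S (\<lambda>x. inverse (f x))"
proof (induction n arbitrary: f)
  case 0 then show ?case by (auto intro: continuous_intros)
next
  case (Suc n)
  have *: "((\<lambda>x. inverse (f x)) has_derivative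
      (\<lambda>v. - (inverse (f x) * frechet_derivative f (at x) v * inverse (f x)))) (at x)"
      if "x \<in> S" for x
    using Suc.prems that by (intro Deriv.has_derivative_inverse) (auto simp: frechet_derivative_works)
  have eq: "frechet_derivative (\<lambda>x. inverse (f x)) (at x) =
      (\<lambda>v. - (inverse (f x) * frechet_derivative f (at x) v * inverse (f x)))" if "x \<in> S" for x
    using frechet_derivative_at[OF *[OF that]] by simp
  have inv: "n_times_differentiable_on n S (\<lambda>x. inverse (f x))"
    using Suc.IH[of f] Suc.prems n_times_differentiable_on_Suc_D[of n S f] by simp
  have "n_times_differentiable_on n S
      (\<lambda>x. (-1) * (inverse (f x) * frechet_derivative f (at x) v * inverse (f x)))" for v
    by (intro n_times_differentiable_on_mult n_times_differentiable_on_const inv Suc.prems(1))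
      (use Suc.prems(2) in auto)
  then have "n_times_differentiable_on n S (\<lambda>x. frechet_derivative (\<lambda>x. inverse (f x)) (at x) v)" for v
    by (rule n_times_differentiable_on_cong[OF \<open>open S\<close>, rotated]) (use eq in auto)
  then show ?case using * by (auto simp: differentiable_def)
qed

lemma n_times_differentiable_on_vec:
  fixes f :: "'a::real_normed_vector \<Rightarrow> complex ^ 'm::finite"
  shows "open S \<Longrightarrow> (\<And>i. n_times_differentiable_on n S (\<lambda>x. f x $ i)) \<Longrightarrow>
    n_times_differentiable_on n S f"
proof (induction n arbitrary: f)
  case 0 
  then have "continuous_on S (\<lambda>x. \<chi> i. f x $ i)" by (intro continuous_on_vec_lambda) auto
  then show ?case by simp
next
  case (Suc n)
  have *: "(f has_derivative (\<lambda>v. \<chi> i. frechet_derivative (\<lambda>x. f x $ i) (at x) v)) (at x)"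
      if "x \<in> S" for x
  proof -
    have h1: "((\<lambda>x. f x $ i) has_derivative (frechet_derivative (\<lambda>x. f x $ i) (at x))) (at x)" for i
      using Suc.prems that by (auto simp: frechet_derivative_works)
    have h2: "bounded_linear (axis i :: complex \<Rightarrow> complex ^ 'm)" for i
      by (intro linear_conv_bounded_linear[THEN iffD1] linearI)
        (auto simp: vec_eq_iff axis_def)
    have "((\<lambda>x. \<Sum>i\<in>UNIV. axis i (f x $ i)) has_derivative
        (\<lambda>v. \<Sum>i\<in>UNIV. axis i (frechet_derivative (\<lambda>x. f x $ i) (at x) v))) (at x)"
      by (rule has_derivative_sum, rule bounded_linear.has_derivative[OF h2 h1])
    moreover have "(\<Sum>i\<in>UNIV. axis i (c i)) = (\<chi> i. c i)" for c :: "'m \<Rightarrow> complex"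
      by (simp add: vec_eq_iff axis_def if_distrib sum.delta cong: if_cong)
    ultimately show ?thesis by simp
  qed
  have eq: "frechet_derivative f (at x) = (\<lambda>v. \<chi> i. frechet_derivative (\<lambda>x. f x $ i) (at x) v)"
      if "x \<in> S" for x
    using frechet_derivative_at[OF *[OF that]] by simp
  have "n_times_differentiable_on n S (\<lambda>x. \<chi> i. frechet_derivative (\<lambda>x. f x $ i) (at x) v)" for v
    using Suc.prems by (intro Suc.IH) auto
  then have "n_times_differentiable_on n S (\<lambda>x. frechet_derivative f (at x) v)" for v
    by (rule n_times_differentiable_on_cong[OF \<open>open S\<close>, rotated]) (use eq in auto)
  then show ?case using * by (auto simp: differentiable_def)
qed

lemma smooth_atlasI:
  assumes "(\<Union>(D, \<phi>)\<in>A. D) = topspace X"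
    and "\<And>D \<phi>. (D, \<phi>) \<in> A \<Longrightarrow> openin X D"
    and "\<And>D \<phi>. (D, \<phi>) \<in> A \<Longrightarrow> open (\<phi> ` D)"
    and "\<And>D \<phi>. (D, \<phi>) \<in> A \<Longrightarrow> homeomorphic_map (subtopology X D) (top_of_set (\<phi> ` D)) \<phi>"
    and "\<And>D \<phi> E \<psi>. (D, \<phi>) \<in> A \<Longrightarrow> (E, \<psi>) \<in> A \<Longrightarrow>
      smooth_on (\<phi> ` (D \<inter> E)) (\<psi> \<circ> inv_into D \<phi>)"
  shows "smooth_atlas X A"
  unfolding smooth_atlas_def
proof (intro conjI)
  show "\<forall>(D, \<phi>)\<in>A. openin X D \<and> open (\<phi> ` D) \<and>
      homeomorphic_map (subtopology X D) (top_of_set (\<phi> ` D)) \<phi>"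
    using assms(2-4) by auto
  show "\<forall>(D, \<phi>)\<in>A. \<forall>(E, \<psi>)\<in>A. smooth_on (\<phi> ` (D \<inter> E)) (\<psi> \<circ> inv_into D \<phi>)"
    using assms(5) by auto
qed (rule assms(1))

definition cp_index_inv :: "'m option \<Rightarrow> 'm option \<Rightarrow> 'm"
  where "cp_index_inv j i = (case i of None \<Rightarrow> the j | Some m \<Rightarrow> m)"

lemma cp_index_inv [simp]:
  "cp_index_inv j (cp_index j m) = m" "cp_index j m \<noteq> j"
  "i \<noteq> j \<Longrightarrow> cp_index j (cp_index_inv j i) = i"
  by (auto simp: cp_index_def cp_index_inv_def split: option.splits)

definition cp_hom :: "'m::finite option \<Rightarrow> complex ^ 'm \<Rightarrow> complex ^ 'm option"
  where "cp_hom j w = (\<chi> i. if i = j then 1 else w $ cp_index_inv j i)"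

lemma cp_point_eq_iff: "cp_point z = cp_point w \<longleftrightarrow> (\<exists>c. c \<noteq> 0 \<and> w = c *s z)"
proof
  assume "cp_point z = cp_point w"
  moreover have "w \<in> cp_point w" by (auto simp: cp_point_def intro!: exI[of _ 1])
  ultimately show "\<exists>c. c \<noteq> 0 \<and> w = c *s z" by (auto simp: cp_point_def)
next
  assume "\<exists>c. c \<noteq> 0 \<and> w = c *s z"
  then obtain c where c: "c \<noteq> 0" "w = c *s z" by blast
  show "cp_point z = cp_point w"
  proof (intro equalityI subsetI)
    fix x assume "x \<in> cp_point z"
    then obtain d where "d \<noteq> 0" "x = d *s z" by (auto simp: cp_point_def)
    then show "x \<in> cp_point w" unfolding cp_point_def using c
      by (intro CollectI exI[of _ "d / c"]) (auto simp: vector_smult_assoc)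
  next
    fix x assume "x \<in> cp_point w"
    then obtain d where "d \<noteq> 0" "x = d *s w" by (auto simp: cp_point_def)
    then show "x \<in> cp_point z" unfolding cp_point_def using c
      by (intro CollectI exI[of _ "d * c"]) (auto simp: vector_smult_assoc)
  qed
qed

lemma cp_chart_cp_point: "cp_chart j (cp_point z) = (\<chi> i. z $ cp_index j i / z $ j)"
proof -
  have "z \<in> cp_point z" by (auto simp: cp_point_def intro!: exI[of _ 1])
  then have "(SOME x. x \<in> cp_point z) \<in> cp_point z" by (rule someI)
  then obtain c where "c \<noteq> 0" "(SOME x. x \<in> cp_point z) = c *s z" by (auto simp: cp_point_def)
  then show ?thesis by (simp add: cp_chart_def Let_def vec_eq_iff)
qed

lemma cp_point_mem_chart_iff: "cp_point z \<in> cp_point ` {z. z $ j \<noteq> 0} \<longleftrightarrow> z $ j \<noteq> 0"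
  by (auto simp: cp_point_eq_iff)

lemma cp_hom_nonzero: "cp_hom j w \<in> {z. z $ j \<noteq> 0}" "cp_hom j w \<noteq> 0"
  by (auto simp: cp_hom_def vec_eq_iff)

lemma cp_chart_cp_hom: "cp_chart j (cp_point (cp_hom j w)) = w"
  by (simp add: cp_chart_cp_point cp_hom_def vec_eq_iff)

lemma cp_hom_cp_chart: "z $ j \<noteq> 0 \<Longrightarrow> cp_point (cp_hom j (cp_chart j (cp_point z))) = cp_point z"
  unfolding cp_point_eq_iff
  by (rule exI[of _ "z $ j"]) (auto simp: cp_chart_cp_point cp_hom_def vec_eq_iff)

lemma quotient_map_cp_point: "quotient_map (top_of_set (UNIV - {0})) cp_top cp_point"
  unfolding cp_top_def by (rule quotient_map_quotient_topology)

lemma open_component_nonzero: "open {z :: complex ^ 'n. z $ j \<noteq> 0}"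
  by (intro open_Collect_neq continuous_intros)

lemma openin_cp_chart_domain: "openin cp_top (cp_point ` {z. z $ j \<noteq> 0})"
proof -
  have "(UNIV - {0}) \<inter> cp_point -` cp_point ` {z. z $ j \<noteq> 0} = {z :: complex ^ 'a option. z $ j \<noteq> 0}"
    using cp_point_mem_chart_iff by fastforce
  then show ?thesis
    using open_component_nonzero[of j]
    by (auto simp: cp_top_def openin_quotient_topology intro!: open_subset)
qed

lemma homeomorphic_maps_cp_chart:
  "homeomorphic_maps (subtopology cp_top (cp_point ` {z. z $ j \<noteq> 0})) euclidean
     (cp_chart j) (\<lambda>w. cp_point (cp_hom j w))"
  unfolding homeomorphic_maps_def
proof (intro conjI ballI)
  let ?D = "cp_point ` {z :: complex ^ 'a option. z $ j \<noteq> 0}"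
  have q: "quotient_map (subtopology (top_of_set (UNIV - {0})) {z. z $ j \<noteq> 0}) (subtopology cp_top ?D) cp_point"
    by (rule quotient_map_restriction[OF quotient_map_cp_point])
      (auto simp: cp_point_mem_chart_iff openin_cp_chart_domain)
  have [simp]: "subtopology (top_of_set (UNIV - {0})) {z. z $ j \<noteq> 0} = top_of_set {z :: complex ^ 'a option. z $ j \<noteq> 0}"
    by (simp add: subtopology_subtopology) (rule arg_cong[where f = "subtopology _"], auto)
  have "continuous_on {z. z $ j \<noteq> 0} (cp_chart j \<circ> cp_point)"
    unfolding o_def cp_chart_cp_point
    by (intro continuous_on_vec_lambda continuous_intros) auto
  then show "continuous_map (subtopology cp_top ?D) euclidean (cp_chart j)"
    unfolding continuous_compose_quotient_map_eq[OF q, symmetric] by simp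
  have "continuous_on UNIV (cp_hom j)"
    unfolding cp_hom_def
  proof (intro continuous_on_vec_lambda)
    fix i show "continuous_on UNIV (\<lambda>w. if i = j then 1 else w $ cp_index_inv j i)"
      by (cases "i = j") (auto intro!: continuous_intros)
  qed
  then have "continuous_map euclidean (top_of_set {z. z $ j \<noteq> 0}) (cp_hom j)"
    using cp_hom_nonzero(1)[of j] by (auto simp: continuous_map_in_subtopology)
  then have "continuous_map euclidean (subtopology cp_top ?D) (cp_point \<circ> cp_hom j)"
    using quotient_imp_continuous_map[OF q] by (auto intro: continuous_map_compose)
  then show "continuous_map euclidean (subtopology cp_top ?D) (\<lambda>w. cp_point (cp_hom j w))"
    by (simp add: o_def)
qed (auto simp: cp_chart_cp_hom cp_hom_cp_chart)

theorem smooth_atlas_cp: "smooth_atlas cp_top cp_atlas"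
proof (rule smooth_atlasI)
  show "(\<Union>(D, \<phi>)\<in>cp_atlas. D) = topspace (cp_top :: (complex ^ 'a option) set topology)"
    unfolding cp_atlas_def by (fastforce simp: cp_top_def vec_eq_iff)
next
  fix D and \<phi> :: "(complex ^ 'a option) set \<Rightarrow> complex ^ 'a" assume "(D, \<phi>) \<in> cp_atlas"
  then obtain j where j: "D = cp_point ` {z. z $ j \<noteq> 0}" "\<phi> = cp_chart j"
    by (auto simp: cp_atlas_def)
  have im: "\<phi> ` D = UNIV" unfolding j
  proof (intro equalityI subsetI)
    fix w :: "complex ^ 'a" 
    show "w \<in> cp_chart j ` cp_point ` {z. z $ j \<noteq> 0}"
      using cp_chart_cp_hom[of j w] cp_hom_nonzero(1)[of j w] by (metis imageI)
  qed simp
  then show "open (\<phi> ` D)" by simp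
  show "openin cp_top D" unfolding j by (rule openin_cp_chart_domain)
  show "homeomorphic_map (subtopology cp_top D) (top_of_set (\<phi> ` D)) \<phi>"
    unfolding im unfolding j using homeomorphic_maps_cp_chart[of j] by (auto simp: homeomorphic_map_maps)
next
  fix D E and \<phi> \<psi> :: "(complex ^ 'a option) set \<Rightarrow> complex ^ 'a"
  assume "(D, \<phi>) \<in> cp_atlas" "(E, \<psi>) \<in> cp_atlas"
  then obtain j k where jk: "D = cp_point ` {z. z $ j \<noteq> 0}" "\<phi> = cp_chart j"
      "E = cp_point ` {z. z $ k \<noteq> 0}" "\<psi> = cp_chart k"
    by (auto simp: cp_atlas_def)
  let ?D = "\<lambda>j. cp_point ` {z :: complex ^ 'a option. z $ j \<noteq> 0}"
  have inv: "inv_into (?D j) (cp_chart j) w = cp_point (cp_hom j w)" for w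
  proof (rule inv_into_f_eq)
    show "inj_on (cp_chart j) (?D j)"
      by (rule inj_on_inverseI[where g = "\<lambda>w. cp_point (cp_hom j w)"]) (auto simp: cp_hom_cp_chart)
  qed (use cp_hom_nonzero(1)[of j w] in \<open>auto simp: cp_chart_cp_hom\<close>)
  have im: "cp_chart j ` (?D j \<inter> ?D k) = {w. cp_hom j w $ k \<noteq> 0}"
  proof (intro equalityI subsetI)
    fix w assume "w \<in> cp_chart j ` (?D j \<inter> ?D k)"
    then obtain z where z: "w = cp_chart j (cp_point z)" "z $ j \<noteq> 0" "z $ k \<noteq> 0"
      using cp_point_mem_chart_iff by blast
    have "cp_point (cp_hom j w) \<in> ?D k" using z cp_hom_cp_chart[of z j] by auto
    then show "w \<in> {w. cp_hom j w $ k \<noteq> 0}" by (simp add: cp_point_mem_chart_iff)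
  next
    fix w assume "w \<in> {w. cp_hom j w $ k \<noteq> 0}"
    then have "cp_point (cp_hom j w) \<in> ?D j \<inter> ?D k"
      using cp_hom_nonzero(1)[of j w] by (auto simp: cp_point_mem_chart_iff)
    then show "w \<in> cp_chart j ` (?D j \<inter> ?D k)"
      by (rule image_eqI[rotated]) (rule cp_chart_cp_hom[symmetric])
  qed
  have hom: "n_times_differentiable_on n S (\<lambda>w. cp_hom j w $ i)" for n S i
  proof (cases "i = j")
    case False
    have "bounded_linear (\<lambda>w :: complex ^ 'a. w $ cp_index_inv j i)" by (rule bounded_linear_vec_nth)
    then show ?thesis
      using n_times_differentiable_on_affine[of "\<lambda>w. w $ cp_index_inv j i" n S 0] False
      by (simp add: cp_hom_def)
  qed (simp add: cp_hom_def n_times_differentiable_on_const)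
  have cont: "continuous_on UNIV (\<lambda>w. cp_hom j w $ k)"
    using hom[of 0 UNIV k] by simp
  have op: "open {w. cp_hom j w $ k \<noteq> 0}"
    by (intro open_Collect_neq cont continuous_on_const)
  show "smooth_on (\<phi> ` (D \<inter> E)) (\<psi> \<circ> inv_into D \<phi>)"
    unfolding jk im smooth_on_def
  proof (intro allI n_times_differentiable_on_vec op)
    fix n i
    show "n_times_differentiable_on n {w. cp_hom j w $ k \<noteq> 0}
        (\<lambda>w. (cp_chart k \<circ> inv_into (?D j) (cp_chart j)) w $ i)"
      unfolding o_def inv cp_chart_cp_point vec_lambda_beta divide_inverse
      by (intro n_times_differentiable_on_mult n_times_differentiable_on_inverse hom op) auto
  qed
qed

definition kt_map :: "int \<Rightarrow> int \<Rightarrow> int \<Rightarrow> int \<Rightarrow> r4 \<Rightarrow> r4"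
  where "kt_map m n l q = (\<lambda>(x, y, z, t). (x + m, y + n, z + m * y + l, t + q))"

lemma kt_map_comp: "kt_map m n l q \<circ> kt_map m' n' l' q' = kt_map (m + m') (n + n') (l + l' + m * n') (q + q')"
  by (auto simp: kt_map_def fun_eq_iff algebra_simps)

lemma kt_map_0: "kt_map 0 0 0 0 = id"
  by (auto simp: kt_map_def fun_eq_iff)

lemma kt_map_inverse:
  "kt_map m n l q \<circ> kt_map (-m) (-n) (m * n - l) (-q) = id"
  "kt_map (-m) (-n) (m * n - l) (-q) \<circ> kt_map m n l q = id"
  by (simp_all add: kt_map_comp flip: kt_map_0)

lemma kt_map_Bij: "kt_map m n l q \<in> Bij UNIV"
  using o_bij[OF kt_map_inverse(2,1)] by (auto simp: Bij_def)

lemma kt_gens: "kt_a = kt_map 1 0 0 0" "kt_b = kt_map 0 1 0 0" "kt_c = kt_map 0 0 1 0" "kt_d = kt_map 0 0 0 1"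
  by (auto simp: kt_map_def kt_a_def kt_b_def kt_c_def kt_d_def fun_eq_iff)

lemma restrict_UNIV: "restrict f UNIV = f"
  by (simp add: restrict_def)

lemma kt_map_inv: "inv\<^bsub>BijGroup UNIV\<^esub> (kt_map m n l q) = kt_map (-m) (-n) (m * n - l) (-q)"
  by (simp add: inv_BijGroup[OF kt_map_Bij] restrict_UNIV inv_unique_comp[OF kt_map_inverse])

lemma kt_map_mult:
  "kt_map m n l q \<otimes>\<^bsub>BijGroup UNIV\<^esub> kt_map m' n' l' q' =
   kt_map (m + m') (n + n') (l + l' + m * n') (q + q')"
  using kt_map_Bij kt_map_comp[of m n l q m' n' l' q']
  by (simp add: BijGroup_def compose_def restrict_UNIV comp_def)

lemma kt_group_imp_kt_map: "g \<in> kt_group \<Longrightarrow> \<exists>m n l q. g = kt_map m n l q"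
  unfolding kt_group_def
proof (induction rule: generate.induct)
  case one
  have "\<one>\<^bsub>BijGroup UNIV\<^esub> = kt_map 0 0 0 0" by (simp add: kt_map_0 BijGroup_def fun_eq_iff)
  then show ?case by metis
next
  case (incl h) then show ?case using kt_gens by auto
next
  case (inv h)
  then obtain m n l q where "h = kt_map m n l q" using kt_gens by auto
  then show ?case using kt_map_inv by metis
next
  case (eng h1 h2) then show ?case using kt_map_mult by metis
qed

lemma subgroup_kt_group: "subgroup kt_group (BijGroup UNIV)"
  unfolding kt_group_def
  by (rule group.generate_is_subgroup[OF group_BijGroup]) (auto simp: kt_gens kt_map_Bij BijGroup_def)

lemma kt_group_id: "id \<in> kt_group"
  using subgroup.one_closed[OF subgroup_kt_group] by (simp add: BijGroup_def id_def restrict_UNIV)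

lemma kt_group_comp: assumes "g \<in> kt_group" "h \<in> kt_group" shows "g \<circ> h \<in> kt_group"
proof -
  have "g \<otimes>\<^bsub>BijGroup UNIV\<^esub> h = g \<circ> h"
    using assms[THEN kt_group_imp_kt_map] kt_map_mult kt_map_comp by metis
  then show ?thesis using subgroup.m_closed[OF subgroup_kt_group assms] by simp
qed

lemma kt_group_inverse:
  assumes "kt_map m n l q \<in> kt_group" shows "kt_map (-m) (-n) (m * n - l) (-q) \<in> kt_group"
  using subgroup.m_inv_closed[OF subgroup_kt_group assms] by (simp add: kt_map_inv)

lemma kt_group_obtain_inverse:
  assumes "g \<in> kt_group" obtains h where "h \<in> kt_group" "g \<circ> h = id" "h \<circ> g = id"
  using kt_group_imp_kt_map[OF assms] kt_group_inverse kt_map_inverse assms by metis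

lemma kt_proj_eq_iff: "kt_proj u = kt_proj v \<longleftrightarrow> (\<exists>g\<in>kt_group. v = g u)"
proof
  assume "kt_proj u = kt_proj v"
  moreover have "v \<in> kt_proj v" unfolding kt_proj_def by (rule image_eqI[OF _ kt_group_id]) simp
  ultimately show "\<exists>g\<in>kt_group. v = g u" by (auto simp: kt_proj_def)
next
  assume "\<exists>g\<in>kt_group. v = g u"
  then obtain g where g: "g \<in> kt_group" "v = g u" by blast
  obtain h where h: "h \<in> kt_group" "g \<circ> h = id" "h \<circ> g = id" using kt_group_obtain_inverse[OF g(1)] .
  show "kt_proj u = kt_proj v"
  proof (intro equalityI subsetI)
    fix x assume "x \<in> kt_proj u"
    then obtain f where f: "f \<in> kt_group" "x = f u" by (auto simp: kt_proj_def)
    have "x = (f \<circ> h) v" using f g h by (simp add: pointfree_idE)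
    then show "x \<in> kt_proj v" unfolding kt_proj_def using kt_group_comp[OF f(1) h(1)] by (rule image_eqI)
  next
    fix x assume "x \<in> kt_proj v"
    then obtain f where f: "f \<in> kt_group" "x = f v" by (auto simp: kt_proj_def)
    have "x = (f \<circ> g) u" using f g by simp
    then show "x \<in> kt_proj u" unfolding kt_proj_def using kt_group_comp[OF f(1) g(1)] by (rule image_eqI)
  qed
qed

lemma kt_map_linear:
  "\<exists>(A :: r4 \<Rightarrow> r4) c. bounded_linear A \<and> kt_map m n l q = (\<lambda>u. A u + c)"
proof (intro exI conjI)
  let ?A = "\<lambda>u :: r4. (fst u, fst (snd u), fst (snd (snd u)) + m * fst (snd u), snd (snd (snd u)))"
  let ?c = "(of_int m, of_int n, of_int l, of_int q) :: r4"
  show "bounded_linear ?A"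
    unfolding linear_conv_bounded_linear[symmetric]
    by (rule linearI) (simp_all add: algebra_simps)
  show "kt_map m n l q = (\<lambda>u. ?A u + ?c)"
    by (simp add: kt_map_def fun_eq_iff)
qed

lemma kt_group_differentiable:
  assumes "g \<in> kt_group" shows "n_times_differentiable_on n S g"
proof -
  obtain m n' l q where g: "g = kt_map m n' l q" using kt_group_imp_kt_map[OF assms] by blast
  obtain A :: "r4 \<Rightarrow> r4" and c where "bounded_linear A" "kt_map m n' l q = (\<lambda>u. A u + c)"
    using kt_map_linear by blast
  then show ?thesis using n_times_differentiable_on_affine g by simp
qed

lemma kt_group_continuous: "g \<in> kt_group \<Longrightarrow> continuous_on S g"
  using kt_group_differentiable[of g 0 S] by simp

lemma open_kt_saturation: assumes "open W" shows "open (kt_proj -` (kt_proj ` W))"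
proof -
  have "kt_proj -` (kt_proj ` W) = (\<Union>g\<in>kt_group. g -` W)"
    by (rule Set.set_eqI) (unfold vimage_eq image_iff kt_proj_eq_iff UN_iff, blast)
  then show ?thesis using assms kt_group_continuous
    by (metis open_UN open_vimage)
qed

lemma openin_kt_top: "openin kt_top U \<longleftrightarrow> U \<subseteq> range kt_proj \<and> open (kt_proj -` U)"
  by (simp add: kt_top_def openin_quotient_topology)

lemma quotient_map_kt_proj: "quotient_map euclidean kt_top kt_proj"
  using quotient_map_quotient_topology[of UNIV kt_proj] by (simp add: kt_top_def)

lemma open_map_kt_proj: "open_map euclidean kt_top kt_proj"
  by (auto simp: open_map_def openin_kt_top open_kt_saturation)

lemma kt_proj_locally_injective:
  obtains V where "open V" "u \<in> V" "inj_on kt_proj V"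
proof -
  obtain a b c d where u: "u = (a, b, c, d)" by (cases u)
  let ?I = "\<lambda>a :: real. {a - 1/2 <..< a + 1/2}"
  let ?V = "?I a \<times> ?I b \<times> ?I c \<times> ?I d"
  have "open ?V" by (intro open_Times open_greaterThanLessThan)
  moreover have "u \<in> ?V" by (simp add: u)
  moreover have "inj_on kt_proj ?V"
  proof (rule inj_onI)
    fix v w assume vw: "v \<in> ?V" "w \<in> ?V" "kt_proj v = kt_proj w"
    then obtain m n l q where w: "w = kt_map m n l q v"
      unfolding kt_proj_eq_iff using kt_group_imp_kt_map by blast
    obtain x y z t where v: "v = (x, y, z, t)" by (cases v)
    have small: "i = 0" if "r \<in> ?I e" "r + of_int i \<in> ?I e" for r e i
      using that by auto
    have "m = 0" using small[of x a m] vw(1,2) by (simp add: v w kt_map_def)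
    moreover have "n = 0" using small[of y b n] vw(1,2) by (simp add: v w kt_map_def)
    moreover have "q = 0" using small[of t d q] vw(1,2) by (simp add: v w kt_map_def)
    moreover have "l = 0" using small[of z c l] vw(1,2) \<open>m = 0\<close> by (simp add: v w kt_map_def)
    ultimately show "v = w" by (simp add: w kt_map_0)
  qed
  ultimately show thesis by (rule that)
qed

theorem smooth_atlas_kt: "smooth_atlas kt_top kt_atlas"
proof (rule smooth_atlasI)
  show "(\<Union>(D, \<phi>)\<in>kt_atlas. D) = topspace kt_top"
  proof (intro equalityI subsetI)
    fix P assume "P \<in> topspace kt_top"
    then obtain u where u: "P = kt_proj u" by (auto simp: kt_top_def)
    obtain V where V: "open V" "u \<in> V" "inj_on kt_proj V" by (rule kt_proj_locally_injective)
    then have "(kt_proj ` V, inv_into V kt_proj) \<in> kt_atlas" by (auto simp: kt_atlas_def)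
    then show "P \<in> (\<Union>(D, \<phi>)\<in>kt_atlas. D)" using u V(2) by blast
  qed (auto simp: kt_atlas_def kt_top_def)
next
  fix D \<phi> assume "(D, \<phi>) \<in> kt_atlas"
  then obtain V where V: "open V" "inj_on kt_proj V" "D = kt_proj ` V" "\<phi> = inv_into V kt_proj"
    by (auto simp: kt_atlas_def)
  have im: "\<phi> ` D = V" using V by (simp add: image_image)
  show "open (\<phi> ` D)" using im V by simp
  show "openin kt_top D" using V open_map_kt_proj by (simp add: open_map_def)
  have "homeomorphic_map (top_of_set V) (subtopology kt_top D) kt_proj"
  proof (rule bijective_open_imp_homeomorphic_map)
    show "continuous_map (top_of_set V) (subtopology kt_top D) kt_proj"
      using quotient_imp_continuous_map[OF quotient_map_kt_proj] V(3)
      by (auto simp: continuous_map_in_subtopology continuous_map_from_subtopology)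
    show "open_map (top_of_set V) (subtopology kt_top D) kt_proj"
      using V open_map_kt_proj \<open>openin kt_top D\<close>
      by (auto simp: open_map_def openin_open_eq openin_open_subtopology)
    show "kt_proj ` topspace (top_of_set V) = topspace (subtopology kt_top D)"
      using V by (auto simp: kt_top_def)
  qed (use V in auto)
  then obtain g where g: "homeomorphic_maps (top_of_set V) (subtopology kt_top D) kt_proj g"
    by (auto simp: homeomorphic_map_maps)
  have "homeomorphic_map (subtopology kt_top D) (top_of_set V) g"
    using g homeomorphic_maps_sym homeomorphic_map_maps by blast
  moreover have "g P = \<phi> P" if "P \<in> topspace (subtopology kt_top D)" for P
    using that g V by (auto simp: homeomorphic_maps_def)
  ultimately show "homeomorphic_map (subtopology kt_top D) (top_of_set (\<phi> ` D)) \<phi>"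
    unfolding im by (rule homeomorphic_map_eq)
next
  fix D \<phi> E \<psi> assume "(D, \<phi>) \<in> kt_atlas" "(E, \<psi>) \<in> kt_atlas"
  then obtain V W where V: "open V" "inj_on kt_proj V" "D = kt_proj ` V" "\<phi> = inv_into V kt_proj"
    and W: "open W" "inj_on kt_proj W" "E = kt_proj ` W" "\<psi> = inv_into W kt_proj"
    by (auto simp: kt_atlas_def)
  have im: "\<phi> ` (D \<inter> E) = V \<inter> kt_proj -` (kt_proj ` W)"
  proof (intro equalityI subsetI)
    fix v assume "v \<in> V \<inter> kt_proj -` (kt_proj ` W)"
    then have "v = \<phi> (kt_proj v)" "kt_proj v \<in> D \<inter> E" using V W by auto
    then show "v \<in> \<phi> ` (D \<inter> E)" by (rule image_eqI)
  next
    fix v assume "v \<in> \<phi> ` (D \<inter> E)"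
    then obtain x where x: "x \<in> V" "kt_proj x \<in> kt_proj ` W" "v = \<phi> (kt_proj x)"
      using V(3) W(3) by blast
    then have "v = x" using V by simp
    then show "v \<in> V \<inter> kt_proj -` (kt_proj ` W)" using x by simp
  qed
  have op: "open (V \<inter> kt_proj -` (kt_proj ` W))"
    using V(1) W(1) open_kt_saturation by (intro open_Int)
  have inv: "inv_into D \<phi> v = kt_proj v" if "v \<in> V" for v
    by (rule inv_into_f_eq) (use V that in \<open>auto intro!: inj_on_inv_into\<close>)
  show "smooth_on (\<phi> ` (D \<inter> E)) (\<psi> \<circ> inv_into D \<phi>)"
    unfolding im smooth_on_def
  proof (intro allI n_times_differentiable_on_local op)
    fix n u assume "u \<in> V \<inter> kt_proj -` (kt_proj ` W)"
    then obtain g where g: "g \<in> kt_group" "g u \<in> W" "u \<in> V"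
      using kt_proj_eq_iff by (auto simp: image_iff) 
    have "n_times_differentiable_on n (V \<inter> g -` W) (\<psi> \<circ> inv_into D \<phi>)"
    proof (rule n_times_differentiable_on_cong[OF _ _ kt_group_differentiable[OF g(1)]])
      show "open (V \<inter> g -` W)"
        using V(1) W(1) kt_group_continuous[OF g(1)] by (intro open_Int open_vimage)
      fix v assume v: "v \<in> V \<inter> g -` W"
      then have "kt_proj v = kt_proj (g v)" using kt_proj_eq_iff g(1) by blast
      then show "g v = (\<psi> \<circ> inv_into D \<phi>) v" using v inv W by simp
    qed
    moreover have "open (V \<inter> g -` W)"
      using V(1) W(1) kt_group_continuous[OF g(1)] by (intro open_Int open_vimage)
    ultimately show "\<exists>T. open T \<and> u \<in> T \<and> n_times_differentiable_on n T (\<psi> \<circ> inv_into D \<phi>)"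
      using g by blast
  qed
qed

end

theory Submission
  imports Defs "HOL-Complex_Analysis.Cauchy_Integral_Formula"
begin

text \<open>A product in the spanning family of the theta functions of degree \<open>k\<close> has a first factor
  that is a classical theta function of \<open>w = z + \<i> x\<close> for the modulus \<open>\<tau> = y + \<i>\<close>, and a second
  factor that is a classical theta function of \<open>v = y + \<i> t\<close> for the modulus \<open>\<i>\<close>. The group acts
  on \<open>w\<close> and \<open>v\<close> by lattice translations and on \<open>\<tau>\<close> by integers, hence with a common multiplier
  (\<open>kt_theta_multiplier\<close>). By the general criterion \<open>smooth_embedding_by_sections\<close> it remains to
  see that the basis is smooth, has no common zero, and separates points and tangent vectors.
  Having the value \<open>0\<close> at a point, having proportional values at two points, and having a
  derivative along a vector proportional to the value are linear conditions with a given factor.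
  They can therefore be moved from the given basis to the products, where the map becomes a pair
  of classical theta maps followed by the Segre embedding.

  For the products, a nonvanishing first factor can be cancelled. The second factors then
  determine \<open>v\<close> modulo the lattice of \<open>\<i>\<close>, and with it \<open>y\<close> and \<open>t\<close>. As \<open>\<tau>\<close> depends only on \<open>y\<close>,
  the first factors at the two points belong to the same modulus and determine \<open>w\<close> modulo the
  lattice of \<open>\<tau>\<close>, that is, \<open>z\<close> and \<open>x\<close> modulo the action of \<open>a\<close> and \<open>c\<close>
  (\<open>kt_theta_separates_points\<close>). The same argument with tangent vectors proves injectivity of the
  derivative (\<open>kt_theta_separates_tangents\<close>).

  This reduces everything to the theorem of Lefschetz for elliptic curves: for \<open>k \<ge> 3\<close> the
  classical theta functions of degree \<open>k\<close> separate points and tangent vectors. A product of \<open>k\<close>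
  translates of a Jacobi theta function is a classical theta function as soon as its zeros have
  the sum \<open>k / 2\<close>. One zero can be prescribed, and the others can be chosen so as to avoid any
  given point (\<open>classical_theta_prescribed_zero\<close>).

  Two analytic facts complete the proof. A function that is holomorphic in two variables is
  smooth, because Cauchy's integral formula shows that its partial derivatives are holomorphic
  again (\<open>separately_holomorphic_deriv_fst\<close>). And a continuous injection from a compact space into
  a Hausdorff space is a topological embedding; compactness of the quotient comes from the unit
  cube, and the Hausdorff property of projective space from the projection matrix of a line.\<close>

section \<open>Classical theta functions with prescribed zeros\<close>

text \<open>The infinite \<open>q\<close>-Pochhammer symbol \<open>(x; q)\<^sub>\<infinity>\<close>, as a limit of partial products. Its zeros are
  what it is needed for, and these will be read off from its functional equation.\<close>
definition q_pochhammer :: "complex \<Rightarrow> complex \<Rightarrow> complex"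
  where "q_pochhammer q x = lim (\<lambda>N. \<Prod>n<N. 1 - q ^ n * x)"

context
  fixes q :: complex
  assumes q: "norm q < 1"
begin

lemma uniform_limit_q_pochhammer:
  "uniform_limit (cball 0 R) (\<lambda>N x. \<Prod>n<N. 1 - q ^ n * x) (q_pochhammer q) sequentially"
proof -
  have "uniformly_convergent_on (cball 0 R) (\<lambda>N x. \<Prod>n<N. 1 + - (q ^ n * x))"
  proof (rule uniformly_convergent_on_prod)
    show "uniformly_convergent_on (cball 0 R) (\<lambda>N x. \<Sum>n<N. norm (- (q ^ n * x)))"
    proof (rule Weierstrass_m_test')
      show "norm (norm (- (q ^ n * x))) \<le> norm q ^ n * R" if "x \<in> cball 0 R" for n x
        using that by (auto simp: norm_mult norm_power intro!: mult_left_mono)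
      show "summable (\<lambda>n. norm q ^ n * R)"
        using q by (intro summable_mult2 summable_geometric) simp
    qed
  qed (auto intro!: continuous_intros)
  then show ?thesis
    unfolding uniformly_convergent_uniform_limit_iff q_pochhammer_def by simp
qed

lemma tendsto_q_pochhammer: "(\<lambda>N. \<Prod>n<N. 1 - q ^ n * x) \<longlonglongrightarrow> q_pochhammer q x"
  using tendsto_uniform_limitI[OF uniform_limit_q_pochhammer[of "norm x"], of x] by simp

lemma holomorphic_q_pochhammer: "q_pochhammer q holomorphic_on UNIV"
proof (rule holomorphic_uniform_sequence[OF open_UNIV])
  show "(\<lambda>x. \<Prod>n<N. 1 - q ^ n * x) holomorphic_on UNIV" for N
    by (intro holomorphic_intros)
  fix x :: complex
  have "cball x 1 \<subseteq> cball 0 (norm x + 1)"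
    by (simp add: cball_subset_cball_iff)
  then show "\<exists>d>0. cball x d \<subseteq> UNIV \<and>
      uniform_limit (cball x d) (\<lambda>N x. \<Prod>n<N. 1 - q ^ n * x) (q_pochhammer q) sequentially"
    using uniform_limit_on_subset[OF uniform_limit_q_pochhammer] by (metis subset_UNIV zero_less_one)
qed

lemma holomorphic_on_q_pochhammer [holomorphic_intros]:
  assumes "f holomorphic_on A"
  shows "(\<lambda>w. q_pochhammer q (f w)) holomorphic_on A"
  using holomorphic_on_compose_gen[OF assms holomorphic_q_pochhammer] by (simp add: o_def)

lemma q_pochhammer_shift: "q_pochhammer q x = (1 - x) * q_pochhammer q (q * x)"
proof (rule LIMSEQ_unique[OF LIMSEQ_Suc[OF tendsto_q_pochhammer]])
  have "(\<Prod>n<Suc N. 1 - q ^ n * x) = (1 - x) * (\<Prod>n<N. 1 - q ^ n * (q * x))" for N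
    by (subst prod.lessThan_Suc_shift) (simp add: mult_ac)
  then show "(\<lambda>N. \<Prod>n<Suc N. 1 - q ^ n * x) \<longlonglongrightarrow> (1 - x) * q_pochhammer q (q * x)"
    using tendsto_mult_left[OF tendsto_q_pochhammer[of "q * x"]] by presburger
qed

lemma q_pochhammer_shift_iterate:
  "q_pochhammer q x = (\<Prod>n<N. 1 - q ^ n * x) * q_pochhammer q (q ^ N * x)"
proof (induction N)
  case (Suc N)
  then show ?case using q_pochhammer_shift[of "q ^ N * x"] by (simp add: mult_ac)
qed simp

lemma q_pochhammer_0: "q_pochhammer q 0 = 1"
  using LIMSEQ_unique[OF tendsto_q_pochhammer[of 0]] by simp

text \<open>The partial products split off all factors that can vanish: \<open>q ^ N * x\<close> tends to \<open>0\<close>, where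
  the function has the value \<open>1\<close>, so the remaining factor is nonzero for large \<open>N\<close>.\<close>
lemma q_pochhammer_eq_0_iff: "q_pochhammer q x = 0 \<longleftrightarrow> (\<exists>n. q ^ n * x = 1)"
proof
  assume zero: "q_pochhammer q x = 0"
  have "(\<lambda>N. q ^ N * x) \<longlonglongrightarrow> 0"
    using tendsto_mult_right[OF LIMSEQ_power_zero[OF q], of x] by simp
  moreover have "isCont (q_pochhammer q) 0"
    using holomorphic_on_imp_differentiable_at[OF holomorphic_q_pochhammer open_UNIV]
    by (simp add: field_differentiable_imp_continuous_at)
  ultimately have "(\<lambda>N. q_pochhammer q (q ^ N * x)) \<longlonglongrightarrow> 1"
    using isCont_tendsto_compose q_pochhammer_0 by metis
  then have "\<forall>\<^sub>F N in sequentially. q_pochhammer q (q ^ N * x) \<noteq> 0"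
    by (rule tendsto_imp_eventually_ne) simp
  then obtain N where "q_pochhammer q (q ^ N * x) \<noteq> 0"
    using eventually_happens' sequentially_bot by blast
  with zero have "(\<Prod>n<N. 1 - q ^ n * x) = 0"
    using q_pochhammer_shift_iterate[of x N] by simp
  then show "\<exists>n. q ^ n * x = 1" by auto
next
  assume "\<exists>n. q ^ n * x = 1"
  then obtain n where "q ^ n * x = 1" by blast
  then show "q_pochhammer q x = 0"
    using q_pochhammer_shift_iterate[of x "Suc n"] by simp
qed

end

definition period_lattice :: "complex \<Rightarrow> complex set"
  where "period_lattice \<tau> = {of_int m + of_int n * \<tau> | m n :: int. True}"

lemma countable_period_lattice: "countable (period_lattice \<tau>)"
proof -
  have "period_lattice \<tau> = (\<lambda>(m, n). of_int m + of_int n * \<tau>) ` (UNIV :: (int \<times> int) set)"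
    by (auto simp: period_lattice_def)
  then show ?thesis by (simp add: countable_image)
qed

lemma period_latticeI: "of_int m + of_int n * \<tau> \<in> period_lattice \<tau>"
  by (auto simp: period_lattice_def)

abbreviation exp_2pi_i :: "complex \<Rightarrow> complex"
  where "exp_2pi_i w \<equiv> exp (2 * of_real pi * \<i> * w)"

lemma exp_2pi_i_add: "exp_2pi_i (v + w) = exp_2pi_i v * exp_2pi_i w"
  by (simp add: exp_add ring_distribs)

lemma exp_2pi_i_eq_1_iff: "exp_2pi_i w = 1 \<longleftrightarrow> (\<exists>n::int. w = of_int n)"
proof -
  have "exp_2pi_i w = 1 \<longleftrightarrow> Im w = 0 \<and> (\<exists>n::int. Re w = of_int n)"
    by (simp add: exp_eq_1)
  also have "\<dots> \<longleftrightarrow> (\<exists>n::int. w = of_int n)"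
    by (auto simp: complex_eq_iff)
  finally show ?thesis .
qed

lemma exp_2pi_i_of_int_add: "exp_2pi_i (of_int m + w) = exp_2pi_i w"
proof -
  have "exp_2pi_i (of_int m) = 1"
    using exp_2pi_i_eq_1_iff by blast
  then show ?thesis by (simp only: exp_2pi_i_add mult_1)
qed

text \<open>Up to a nowhere vanishing factor this is the odd Jacobi theta function in its product form.
  The product form shows the zeros: they are the zeros of the factors \<open>1 - exp_2pi_i (n * \<tau> + w)\<close>
  and \<open>1 - exp_2pi_i ((n + 1) * \<tau> - w)\<close> for \<open>n \<ge> 0\<close>, that is, the period lattice.\<close>
definition theta_prod :: "complex \<Rightarrow> complex \<Rightarrow> complex"
  where "theta_prod \<tau> w = q_pochhammer (exp_2pi_i \<tau>) (exp_2pi_i w)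
      * q_pochhammer (exp_2pi_i \<tau>) (exp_2pi_i (\<tau> - w))"

context
  fixes \<tau> :: complex
  assumes \<tau>: "Im \<tau> > 0"
begin

lemma norm_exp_2pi_i_less_1: "norm (exp_2pi_i \<tau>) < 1"
  using \<tau> by simp

lemma holomorphic_theta_prod: "theta_prod \<tau> holomorphic_on UNIV"
  unfolding theta_prod_def[abs_def]
  by (intro holomorphic_intros holomorphic_on_q_pochhammer[OF norm_exp_2pi_i_less_1])

lemma holomorphic_on_theta_prod:
  assumes "f holomorphic_on A"
  shows "(\<lambda>w. theta_prod \<tau> (f w)) holomorphic_on A"
  using holomorphic_on_compose_gen[OF assms holomorphic_theta_prod] by (simp add: o_def)

lemma theta_prod_add_1: "theta_prod \<tau> (w + 1) = theta_prod \<tau> w"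
proof -
  have "w + 1 = of_int 1 + w" "\<tau> - (w + 1) = of_int (- 1) + (\<tau> - w)" by simp_all
  then show ?thesis by (simp only: theta_prod_def exp_2pi_i_of_int_add)
qed

text \<open>Passing from \<open>w\<close> to \<open>w + \<tau>\<close> removes the factor \<open>1 - exp_2pi_i w\<close> from the first product and
  adds the factor \<open>1 - exp_2pi_i (- w)\<close> to the second one; their quotient is \<open>- exp_2pi_i (- w)\<close>.\<close>
lemma theta_prod_add_period: "theta_prod \<tau> (w + \<tau>) = - exp_2pi_i (- w) * theta_prod \<tau> w"
proof -
  have 1: "q_pochhammer (exp_2pi_i \<tau>) (exp_2pi_i w)
      = (1 - exp_2pi_i w) * q_pochhammer (exp_2pi_i \<tau>) (exp_2pi_i (w + \<tau>))"
    using q_pochhammer_shift[OF norm_exp_2pi_i_less_1, of "exp_2pi_i w"]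
        by (simp only: exp_2pi_i_add[of w] mult.commute[of "exp_2pi_i w" "exp_2pi_i \<tau>"])
  have 2: "q_pochhammer (exp_2pi_i \<tau>) (exp_2pi_i (- w)) = (1 - exp_2pi_i (- w))
      * q_pochhammer (exp_2pi_i \<tau>) (exp_2pi_i (\<tau> - w))"
    using q_pochhammer_shift[OF norm_exp_2pi_i_less_1, of "exp_2pi_i (- w)"]
    by (simp only: exp_2pi_i_add diff_conv_add_uminus)
  have "1 - exp_2pi_i (- w) = - exp_2pi_i (- w) * (1 - exp_2pi_i w)"
  proof -
    have "exp_2pi_i (- w) * exp_2pi_i w = 1" by (simp flip: exp_add)
    moreover have "1 - y = - y * (1 - x)" if "y * x = 1" for x y :: complex
      using that by (simp add: algebra_simps)
    ultimately show ?thesis by blast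
  qed
  with 1 2 show ?thesis by (simp add: theta_prod_def)
qed

lemma theta_prod_eq_0_iff: "theta_prod \<tau> w = 0 \<longleftrightarrow> w \<in> period_lattice \<tau>"
proof -
  have pow: "exp_2pi_i \<tau> ^ n * exp_2pi_i v = exp_2pi_i (of_nat n * \<tau> + v)" for n v
    by (simp add: ring_distribs exp_add mult_ac flip: exp_of_nat_mult)
  have "theta_prod \<tau> w = 0 \<longleftrightarrow>
      (\<exists>n m. of_nat n * \<tau> + w = of_int m) \<or> (\<exists>n m. of_nat n * \<tau> + (\<tau> - w) = of_int m)"
    by (simp only: theta_prod_def mult_eq_0_iff q_pochhammer_eq_0_iff[OF norm_exp_2pi_i_less_1] pow
        exp_2pi_i_eq_1_iff)
  also have "\<dots> \<longleftrightarrow> w \<in> period_lattice \<tau>"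
  proof
    assume "(\<exists>n m. of_nat n * \<tau> + w = of_int m) \<or> (\<exists>n m. of_nat n * \<tau> + (\<tau> - w) = of_int m)"
    then show "w \<in> period_lattice \<tau>"
    proof (elim disjE exE)
      fix n m assume "of_nat n * \<tau> + w = of_int m"
      then have "w = of_int m + of_int (- int n) * \<tau>" by (simp add: algebra_simps)
      then show ?thesis using period_latticeI by metis
    next
      fix n m assume "of_nat n * \<tau> + (\<tau> - w) = of_int m"
      then have "w = of_int (- m) + of_int (int n + 1) * \<tau>" by (simp add: algebra_simps)
      then show ?thesis using period_latticeI by metis
    qed
  next
    assume "w \<in> period_lattice \<tau>"
    then obtain m n :: int where w: "w = of_int m + of_int n * \<tau>" by (auto simp: period_lattice_def)
    show "(\<exists>n m. of_nat n * \<tau> + w = of_int m) \<or> (\<exists>n m. of_nat n * \<tau> + (\<tau> - w) = of_int m)"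
    proof (cases "n \<le> 0")
      case True
      then have "of_nat (nat (- n)) * \<tau> + w = of_int m" by (simp add: w)
      then show ?thesis by blast
    next
      case False
      then have "of_nat (nat (n - 1)) * \<tau> + (\<tau> - w) = of_int (- m)" by (simp add: w algebra_simps)
      then show ?thesis by blast
    qed
  qed
  finally show ?thesis .
qed

text \<open>The zero at the origin is simple because it comes from the single factor \<open>1 - exp_2pi_i w\<close>;
  the product \<open>R\<close> of all the other factors does not vanish there.\<close>
lemma theta_prod_deriv_0: "\<exists>d. d \<noteq> 0 \<and> (theta_prod \<tau> has_field_derivative d) (at 0)"
proof -
  define R where "R = (\<lambda>w. q_pochhammer (exp_2pi_i \<tau>) (exp_2pi_i \<tau> * exp_2pi_i w)
      * q_pochhammer (exp_2pi_i \<tau>) (exp_2pi_i (\<tau> - w)))"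
  have eq: "theta_prod \<tau> = (\<lambda>w. (1 - exp_2pi_i w) * R w)"
  proof
    fix w show "theta_prod \<tau> w = (1 - exp_2pi_i w) * R w"
      using q_pochhammer_shift[OF norm_exp_2pi_i_less_1, of "exp_2pi_i w"]
      by (simp only: theta_prod_def R_def mult.assoc)
  qed
  have "R holomorphic_on UNIV"
    unfolding R_def
    by (intro holomorphic_intros holomorphic_on_q_pochhammer[OF norm_exp_2pi_i_less_1])
  then obtain r where r: "(R has_field_derivative r) (at 0)"
    using holomorphic_on_imp_differentiable_at[of R UNIV 0] by (auto simp: field_differentiable_def)
  have "(theta_prod \<tau> has_field_derivative - (2 * of_real pi * \<i>) * R 0) (at 0)"
    unfolding eq using r by (auto intro!: derivative_eq_intros)
  moreover have "R 0 \<noteq> 0"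
  proof -
    have "exp_2pi_i \<tau> ^ n * exp_2pi_i \<tau> \<noteq> 1" for n
    proof -
      have "norm (exp_2pi_i \<tau>) ^ Suc n < 1"
        using norm_exp_2pi_i_less_1 by (intro power_Suc_less_one) auto
      then have "norm (exp_2pi_i \<tau> ^ n * exp_2pi_i \<tau>) < 1"
        by (simp only: norm_mult norm_power power_Suc2)
      then show ?thesis by force
    qed
    then show ?thesis by (simp add: R_def q_pochhammer_eq_0_iff[OF norm_exp_2pi_i_less_1])
  qed
  ultimately show ?thesis by (intro exI conjI) auto
qed

text \<open>Each translate contributes the multiplier \<open>- exp_2pi_i (a j - v)\<close>. The \<open>k\<close> signs and the
  shifts \<open>a j\<close> combine to \<open>exp_2pi_i (k / 2 + (\<Sum>j<k. a j))\<close>, which is \<open>1\<close> under the condition on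
  the sum of the zeros.\<close>
lemma prod_theta_prod_in_classical_theta:
  fixes a :: "nat \<Rightarrow> complex"
  assumes sum: "(\<Sum>j<k. a j) = of_nat k / 2"
  shows "(\<lambda>v. \<Prod>j<k. theta_prod \<tau> (v - a j)) \<in> classical_theta k \<tau>"
  unfolding classical_theta_def
proof (intro CollectI conjI allI)
  show "(\<lambda>v. \<Prod>j<k. theta_prod \<tau> (v - a j)) holomorphic_on UNIV"
    by (intro holomorphic_intros holomorphic_on_theta_prod)
  show "(\<Prod>j<k. theta_prod \<tau> (v + 1 - a j)) = (\<Prod>j<k. theta_prod \<tau> (v - a j))" for v
    using theta_prod_add_1 by (intro prod.cong refl) (metis add_diff_eq diff_add_eq)
  fix v
  have "(\<Prod>j<k. theta_prod \<tau> (v + \<tau> - a j)) = (\<Prod>j<k. - exp_2pi_i (a j - v) * theta_prod \<tau> (v - a j))"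
  proof (intro prod.cong refl)
    fix j show "theta_prod \<tau> (v + \<tau> - a j) = - exp_2pi_i (a j - v) * theta_prod \<tau> (v - a j)"
      using theta_prod_add_period[of "v - a j"] by (simp add: algebra_simps)
  qed
  also have "\<dots> = (\<Prod>j<k. - exp_2pi_i (a j - v)) * (\<Prod>j<k. theta_prod \<tau> (v - a j))"
    by (rule prod.distrib)
  also have "(\<Prod>j<k. - exp_2pi_i (a j - v)) = exp (- 2 * of_real pi * \<i> * of_nat k * v)"
  proof -
    have "- exp_2pi_i (a j - v) = exp_2pi_i (a j - v + 1 / 2)" for j
      using exp_2pi_i_add[of "a j - v" "1 / 2"] by (simp add: exp_pi_i mult_ac)
    then have "(\<Prod>j<k. - exp_2pi_i (a j - v)) = exp_2pi_i (\<Sum>j<k. a j - v + 1 / 2)"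
      by (simp add: exp_sum sum_distrib_left)
    also have "(\<Sum>j<k. a j - v + 1 / 2) = (\<Sum>j<k. a j) - of_nat k * v + of_nat k / 2"
      by (simp add: sum.distrib sum_subtractf)
    also have "\<dots> = of_int (int k) + of_nat k * (- v)"
      by (simp add: sum)
    finally show ?thesis unfolding exp_2pi_i_of_int_add by (simp add: mult_ac)
  qed
  finally show "(\<Prod>j<k. theta_prod \<tau> (v + \<tau> - a j)) =
      exp (- 2 * of_real pi * \<i> * of_nat k * v) * (\<Prod>j<k. theta_prod \<tau> (v - a j))" .
qed

lemma half_notin_period_lattice: "1 / 2 \<notin> period_lattice \<tau>"
proof
  assume "1 / 2 \<in> period_lattice \<tau>"
  then obtain m n :: int where mn: "1 / 2 = of_int m + of_int n * \<tau>" by (auto simp: period_lattice_def)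
  then have "n = 0" using \<tau> arg_cong[OF mn, of Im] by simp
  then have "1 / 2 = (of_int m :: real)" using arg_cong[OF mn, of Re] by simp
  then have "2 * m = 1" by linarith
  then show False by presburger
qed

text \<open>This is where \<open>k \<ge> 3\<close> enters. With one zero \<open>a\<close> prescribed, at least two more zeros \<open>s\<close> and
  \<open>c - s\<close> remain, of which only the sum \<open>c\<close> is determined. So \<open>s\<close> ranges over the whole plane, and
  all but countably many choices keep both zeros away from the lattice translates of \<open>w\<close>.\<close>
lemma classical_theta_prescribed_zero:
  assumes "k \<ge> 3"
  obtains h where "h holomorphic_on UNIV" "h w \<noteq> 0"
    "(\<lambda>v. theta_prod \<tau> (v - a) * h v) \<in> classical_theta k \<tau>"
proof -
  \<comment> \<open>The remaining \<open>k - 3\<close> zeros are placed half a period away from \<open>w\<close>.\<close>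
  define b where "b = w - 1 / 2"
  define c where "c = of_nat k / 2 - a - of_nat (k - 3) * b"
  have "countable ((\<lambda>l. w - l) ` period_lattice \<tau> \<union> (\<lambda>l. l + (c - w)) ` period_lattice \<tau>)"
    using countable_period_lattice by blast
  then obtain s where s: "s \<notin> (\<lambda>l. w - l) ` period_lattice \<tau>" "s \<notin> (\<lambda>l. l + (c - w)) ` period_lattice \<tau>"
    using uncountable_UNIV_complex by (metis UnCI UNIV_I countable_subset subsetI)
  have s1: "w - s \<notin> period_lattice \<tau>"
    using s(1) by (metis diff_diff_eq2 add_diff_cancel_left' image_eqI)
  have s2: "w - (c - s) \<notin> period_lattice \<tau>"
    using s(2) by (metis (no_types, lifting) add.commute add_diff_cancel_right' diff_add_cancel
        diff_diff_eq2 image_eqI)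
  have b: "w - b \<notin> period_lattice \<tau>"
    using half_notin_period_lattice by (simp add: b_def)
  define z where "z = (\<lambda>j. if j = 0 then a else if j = Suc 0 then s
      else if j = Suc (Suc 0) then c - s else b)"
  define l where "l = k - 3"
  have k: "k = Suc (Suc (Suc l))" using assms by (simp add: l_def)
  have "(\<Sum>j<k. z j) = a + (s + ((c - s) + of_nat l * b))"
    unfolding k by (simp del: sum.lessThan_Suc add: sum.lessThan_Suc_shift z_def)
  also have "\<dots> = of_nat k / 2" by (simp add: c_def flip: l_def)
  finally have mem: "(\<lambda>v. \<Prod>j<k. theta_prod \<tau> (v - z j)) \<in> classical_theta k \<tau>"
    by (rule prod_theta_prod_in_classical_theta)
  define h where "h = (\<lambda>v. theta_prod \<tau> (v - s) * (theta_prod \<tau> (v - (c - s))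
      * theta_prod \<tau> (v - b) ^ l))"
  have "(\<lambda>v. \<Prod>j<k. theta_prod \<tau> (v - z j)) = (\<lambda>v. theta_prod \<tau> (v - a) * h v)"
    unfolding k h_def by (simp del: prod.lessThan_Suc add: prod.lessThan_Suc_shift z_def)
  moreover have "h holomorphic_on UNIV"
    unfolding h_def
    by (intro holomorphic_intros holomorphic_on_theta_prod)
  moreover have "h w \<noteq> 0"
    using s1 s2 b by (simp add: h_def theta_prod_eq_0_iff)
  ultimately show thesis using mem that by metis
qed

lemma classical_theta_separates:
  assumes "k \<ge> 3" "w - a \<notin> period_lattice \<tau>"
  obtains f where "f \<in> classical_theta k \<tau>" "f a = 0" "f w \<noteq> 0"
proof -
  obtain h where h: "h w \<noteq> 0" "(\<lambda>v. theta_prod \<tau> (v - a) * h v) \<in> classical_theta k \<tau>"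
    using classical_theta_prescribed_zero[OF assms(1)] by metis
  have "theta_prod \<tau> (a - a) = 0"
    using theta_prod_eq_0_iff[of 0] period_latticeI[of 0 0 \<tau>] by simp
  then show thesis using that[OF h(2)] h(1) assms(2) theta_prod_eq_0_iff by simp
qed

lemma classical_theta_no_base_point:
  assumes "k \<ge> 3"
  obtains f where "f \<in> classical_theta k \<tau>" "f w \<noteq> 0"
  using classical_theta_separates[OF assms, of w "w - 1 / 2"] half_notin_period_lattice by auto

lemma classical_theta_simple_zero:
  assumes "k \<ge> 3"
  obtains f d where "f \<in> classical_theta k \<tau>" "f w = 0" "(f has_field_derivative d) (at w)" "d \<noteq> 0"
proof -
  obtain h where h: "h holomorphic_on UNIV" "h w \<noteq> 0" "(\<lambda>v. theta_prod \<tau> (v - w) * h v)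
      \<in> classical_theta k \<tau>"
    using classical_theta_prescribed_zero[OF assms(1)] by metis
  obtain d where d: "d \<noteq> 0" "(theta_prod \<tau> has_field_derivative d) (at 0)"
    using theta_prod_deriv_0 by blast
  obtain e where e: "(h has_field_derivative e) (at w)"
    using h(1) holomorphic_on_imp_differentiable_at[of h UNIV w]
        by (auto simp: field_differentiable_def)
  have zero: "theta_prod \<tau> (w - w) = 0"
    using theta_prod_eq_0_iff[of 0] period_latticeI[of 0 0 \<tau>] by simp
  have "((\<lambda>v. theta_prod \<tau> (v - w)) has_field_derivative d * 1) (at w)"
    by (rule DERIV_chain2) (use d(2) in \<open>auto intro!: derivative_eq_intros\<close>)
  from DERIV_mult[OF this e]
  have "((\<lambda>v. theta_prod \<tau> (v - w) * h v) has_field_derivative d * h w) (at w)"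
    using zero by simp
  then show thesis using that[OF h(3)] zero d(1) h(2) by simp
qed

end

section \<open>Smoothness of holomorphic functions of two variables\<close>

text \<open>Continuity together with holomorphy in each variable. On open sets this is the same as
  \<^const>\<open>holomorphic2_on\<close>, but it is the form in which the property passes from a function to its
  partial derivatives.\<close>
definition separately_holomorphic_on :: "(complex \<times> complex \<Rightarrow> complex) \<Rightarrow> (complex \<times> complex) set \<Rightarrow> bool"
  where "separately_holomorphic_on F S \<longleftrightarrow> continuous_on S F \<and>
    (\<forall>(w, \<tau>)\<in>S. (\<lambda>v. F (v, \<tau>)) field_differentiable (at w) \<and> (\<lambda>\<sigma>. F (w, \<sigma>)) field_differentiable
        (at \<tau>))"

lemma separately_holomorphic_onD:
  assumes "separately_holomorphic_on F S"
  shows "continuous_on S F"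
    and "(w, \<tau>) \<in> S \<Longrightarrow> (\<lambda>v. F (v, \<tau>)) field_differentiable (at w)"
    and "(w, \<tau>) \<in> S \<Longrightarrow> (\<lambda>\<sigma>. F (w, \<sigma>)) field_differentiable (at \<tau>)"
  using assms by (auto simp: separately_holomorphic_on_def)

definition deriv_fst :: "(complex \<times> complex \<Rightarrow> complex) \<Rightarrow> complex \<times> complex \<Rightarrow> complex"
  where "deriv_fst F = (\<lambda>(w, \<tau>). deriv (\<lambda>v. F (v, \<tau>)) w)"

definition deriv_snd :: "(complex \<times> complex \<Rightarrow> complex) \<Rightarrow> complex \<times> complex \<Rightarrow> complex"
  where "deriv_snd F = (\<lambda>(w, \<tau>). deriv (\<lambda>\<sigma>. F (w, \<sigma>)) \<tau>)"

lemma holomorphic2_partials: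
  assumes "(F has_derivative (\<lambda>(u, v). \<alpha> * u + \<beta> * v)) (at (w, \<tau>))"
  shows "((\<lambda>v. F (v, \<tau>)) has_field_derivative \<alpha>) (at w)"
    and "((\<lambda>\<sigma>. F (w, \<sigma>)) has_field_derivative \<beta>) (at \<tau>)"
proof -
  have 1: "((\<lambda>v. (v, \<tau>)) has_derivative (\<lambda>h. (h, 0))) (at w)"
    by (auto intro!: derivative_eq_intros)
  have 2: "((\<lambda>\<sigma>. (w, \<sigma>)) has_derivative (\<lambda>h. (0, h))) (at \<tau>)"
    by (auto intro!: derivative_eq_intros)
  show "((\<lambda>v. F (v, \<tau>)) has_field_derivative \<alpha>) (at w)"
    using diff_chain_at[OF 1 assms] by (simp add: has_field_derivative_def o_def)
  show "((\<lambda>\<sigma>. F (w, \<sigma>)) has_field_derivative \<beta>) (at \<tau>)"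
    using diff_chain_at[OF 2 assms] by (simp add: has_field_derivative_def o_def)
qed

lemma holomorphic2_imp_separately_holomorphic:
  assumes "holomorphic2_on F S"
  shows "separately_holomorphic_on F S"
proof -
  have "continuous (at p) F" if p: "p \<in> S" for p
    using assms p has_derivative_continuous unfolding holomorphic2_on_def by blast
  moreover have "(\<lambda>v. F (v, \<tau>)) field_differentiable (at w) \<and> (\<lambda>\<sigma>. F (w, \<sigma>)) field_differentiable
      (at \<tau>)"
    if "(w, \<tau>) \<in> S" for w \<tau>
    using assms that holomorphic2_partials unfolding holomorphic2_on_def field_differentiable_def
        by blast
  ultimately show ?thesis
    by (auto simp: separately_holomorphic_on_def continuous_at_imp_continuous_on)
qed

lemma separately_holomorphic_swap:
  assumes "separately_holomorphic_on F S"
  shows "separately_holomorphic_on (F \<circ> prod.swap) (prod.swap ` S)"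
proof -
  have "continuous_on (prod.swap ` S) (F \<circ> prod.swap)"
    using assms by (intro continuous_on_compose continuous_on_swap)
      (auto simp: separately_holomorphic_on_def image_image)
  then show ?thesis
    using assms by (fastforce simp: separately_holomorphic_on_def o_def)
qed

lemma deriv_snd_eq_swap: "deriv_snd F = deriv_fst (F \<circ> prod.swap) \<circ> prod.swap"
  by (simp add: fun_eq_iff deriv_snd_def deriv_fst_def o_def)

lemma open_swap_image:
  fixes S :: "('a::topological_space \<times> 'b::topological_space) set"
  assumes "open S" shows "open (prod.swap ` S)"
proof -
  have "prod.swap ` S = prod.swap -` S" by force
  then show ?thesis using assms by (simp add: open_vimage continuous_on_swap)
qed

abbreviation circle_vec :: "real \<Rightarrow> real \<Rightarrow> complex"
  where "circle_vec r t \<equiv> of_real r * exp (2 * of_real pi * \<i> * of_real t)"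

text \<open>Cauchy's formula for the derivative at the centre of the circle. The circle moves along with
  the point, so that the derivative depends on the point only through the values of \<open>f\<close>;
  continuity and differentiability in a parameter then carry over from \<open>f\<close> to the integral.\<close>
lemma deriv_eq_circle_mean:
  assumes "r > 0" "\<And>u. u \<in> cball z r \<Longrightarrow> f field_differentiable (at u)"
  shows "deriv f z = integral (cbox 0 1)
    (\<lambda>t::real. f (z + circle_vec r t) / circle_vec r t)"
proof -
  have hol: "f holomorphic_on cball z r"
    using assms(2) by (auto simp: holomorphic_on_def intro: field_differentiable_at_within)
  have "(f has_field_derivative
      (1 / (2 * of_real pi * \<i>) * contour_integral (circlepath z r) (\<lambda>u. f u / (u - z)\<^sup>2))) (at z)"
    using hol assms(1) holomorphic_on_subset[OF hol ball_subset_cball]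
    by (intro Cauchy_derivative_integral_circlepath) (auto intro: holomorphic_on_imp_continuous_on)
  then have "deriv f z = 1 / (2 * of_real pi * \<i>) * contour_integral (circlepath z r) (\<lambda>u. f u
      / (u - z)\<^sup>2)"
    by (rule DERIV_imp_deriv)
  also have "\<dots> = 1 / (2 * of_real pi * \<i>) * integral {0..1} (\<lambda>t. f (circlepath z r t)
      / (circlepath z r t - z)\<^sup>2 *
      vector_derivative (circlepath z r) (at t))"
    by (simp add: contour_integral_integral)
  also have "\<dots> = integral {0..1} (\<lambda>t. 1 / (2 * of_real pi * \<i>) * (f (circlepath z r t)
      / (circlepath z r t - z)\<^sup>2 *
      vector_derivative (circlepath z r) (at t)))"
    by (rule integral_mult_right[symmetric])
  also have "\<dots> = integral {0..1} (\<lambda>t::real. f (z + circle_vec r t) / circle_vec r t)"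
  proof (rule integral_cong)
    fix t :: real
    show "1 / (2 * of_real pi * \<i>) * (f (circlepath z r t) / (circlepath z r t - z)\<^sup>2
        * vector_derivative (circlepath z r) (at t))
      = f (z + circle_vec r t) / circle_vec r t"
      using assms(1) unfolding vector_derivative_circlepath unfolding circlepath
          by (simp add: power2_eq_square field_simps)
  qed
  finally show ?thesis by simp
qed

text \<open>A common radius for all points near a given one makes the formula usable for continuity and
  for differentiation under the integral.\<close>
lemma deriv_fst_local_integral:
  assumes "open S" "separately_holomorphic_on F S" "(w\<^sub>0, \<tau>\<^sub>0) \<in> S"
  obtains r where "r > 0" "\<And>w \<tau> u. w \<in> ball w\<^sub>0 r \<Longrightarrow> \<tau> \<in> ball \<tau>\<^sub>0 r \<Longrightarrow> u \<in> cball w r \<Longrightarrow> (u, \<tau>) \<in> S"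
    "\<And>w \<tau>. w \<in> ball w\<^sub>0 r \<Longrightarrow> \<tau> \<in> ball \<tau>\<^sub>0 r \<Longrightarrow> deriv_fst F (w, \<tau>) =
      integral (cbox 0 1) (\<lambda>t::real. F (w + circle_vec r t, \<tau>) /
        circle_vec r t)"
proof -
  obtain A B where AB: "open A" "open B" "(w\<^sub>0, \<tau>\<^sub>0) \<in> A \<times> B" "A \<times> B \<subseteq> S"
    by (rule open_prod_elim[OF assms(1,3)])
  obtain a b where ab: "a > 0" "ball w\<^sub>0 a \<subseteq> A" "b > 0" "ball \<tau>\<^sub>0 b \<subseteq> B"
    using AB(1-3) by (meson mem_Sigma_iff open_contains_ball)
  define r where "r = min (a / 2) b"
  have "r > 0" using ab by (simp add: r_def)
  have mem: "(u, \<tau>) \<in> S" if "w \<in> ball w\<^sub>0 r" "\<tau> \<in> ball \<tau>\<^sub>0 r" "u \<in> cball w r" for w \<tau> u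
  proof -
    have "dist w\<^sub>0 u \<le> dist w\<^sub>0 w + dist w u" by (rule dist_triangle)
    also have "\<dots> < a" using that by (simp add: r_def)
    finally have "u \<in> A" using ab(2) by auto
    moreover have "\<tau> \<in> B" using ab(4) that(2) by (auto simp: r_def)
    ultimately show ?thesis using AB(4) by blast
  qed
  have "deriv_fst F (w, \<tau>) =
      integral (cbox 0 1) (\<lambda>t::real. F (w + circle_vec r t, \<tau>) /
        circle_vec r t)" if "w \<in> ball w\<^sub>0 r" "\<tau> \<in> ball \<tau>\<^sub>0 r" for w \<tau>
    unfolding deriv_fst_def prod.case
  proof (rule deriv_eq_circle_mean[OF \<open>r > 0\<close>])
    fix u assume "u \<in> cball w r"
    from mem[OF that this] show "(\<lambda>v. F (v, \<tau>)) field_differentiable (at u)"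
      using assms(2) by (auto simp: separately_holomorphic_on_def)
  qed
  with \<open>r > 0\<close> mem show thesis by (rule that)
qed

lemma circle_point_mem: "r > 0 \<Longrightarrow> w + circle_vec r t \<in> cball w r"
  by (simp add: dist_norm norm_mult)

lemma continuous_on_circle_integrand:
  assumes "continuous_on S G" "r > 0"
    and "\<And>w \<tau> u. w \<in> A \<Longrightarrow> \<tau> \<in> B \<Longrightarrow> u \<in> cball w r \<Longrightarrow> (u, \<tau>) \<in> S"
  shows "continuous_on ((A \<times> B) \<times> X) (\<lambda>(p, t::real). G (fst p + circle_vec r t, snd p) /
        circle_vec r t)"
  unfolding case_prod_beta
proof (rule continuous_on_divide)
  have "(\<lambda>x. (fst (fst x) + circle_vec r (snd x), snd (fst x))) ` ((A \<times> B) \<times> X) \<subseteq> S"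
    using assms(3) circle_point_mem[OF assms(2)] by fastforce
  then show "continuous_on ((A \<times> B) \<times> X)
      (\<lambda>x. G (fst (fst x) + circle_vec r (snd x), snd (fst x)))"
    by (rule continuous_on_compose2[OF assms(1), rotated]) (intro continuous_intros)
qed (use assms(2) in \<open>auto intro!: continuous_intros\<close>)

lemma continuous_on_deriv_fst:
  assumes "open S" "separately_holomorphic_on F S"
  shows "continuous_on S (deriv_fst F)"
proof (rule continuous_at_imp_continuous_on, rule ballI)
  fix p assume "p \<in> S"
  then obtain w\<^sub>0 \<tau>\<^sub>0 where p: "p = (w\<^sub>0, \<tau>\<^sub>0)" "(w\<^sub>0, \<tau>\<^sub>0) \<in> S" by (cases p) auto
  obtain r where r: "r > 0" "\<And>w \<tau> u. w \<in> ball w\<^sub>0 r \<Longrightarrow> \<tau> \<in> ball \<tau>\<^sub>0 r \<Longrightarrow> u \<in> cball w r \<Longrightarrow> (u, \<tau>) \<in> S"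
    "\<And>w \<tau>. w \<in> ball w\<^sub>0 r \<Longrightarrow> \<tau> \<in> ball \<tau>\<^sub>0 r \<Longrightarrow> deriv_fst F (w, \<tau>) =
      integral (cbox 0 1) (\<lambda>t::real. F (w + circle_vec r t, \<tau>) /
        circle_vec r t)"
    using deriv_fst_local_integral[OF assms p(2)] by blast
  let ?U = "ball w\<^sub>0 r \<times> ball \<tau>\<^sub>0 r"
  have "continuous_on ?U (\<lambda>p. integral (cbox 0 1) (\<lambda>t::real. F (fst p + circle_vec r t, snd p) /
        circle_vec r t))"
    using assms(2) r
    by (intro integral_continuous_on_param continuous_on_circle_integrand)
      (auto simp: separately_holomorphic_on_def)
  then have "continuous_on ?U (deriv_fst F)"
    by (rule continuous_on_eq) (use r(3) in auto)
  moreover have "open ?U" "p \<in> ?U" using r(1) p by (auto intro: open_Times)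
  ultimately show "isCont (deriv_fst F) p" using continuous_on_eq_continuous_at by blast
qed

lemma continuous_on_deriv_snd:
  assumes "open S" "separately_holomorphic_on F S"
  shows "continuous_on S (deriv_snd F)"
proof -
  have "continuous_on (prod.swap ` S) (deriv_fst (F \<circ> prod.swap))"
    by (intro continuous_on_deriv_fst separately_holomorphic_swap assms open_swap_image)
  then show ?thesis
    unfolding deriv_snd_eq_swap by (intro continuous_on_compose continuous_on_swap)
qed

text \<open>Holomorphy in the first variable is the holomorphy of derivatives in one variable.
  Holomorphy in the second one is differentiation under Cauchy's integral, whose Leibniz rule asks
  for the joint continuity of the other partial derivative.\<close>
lemma separately_holomorphic_deriv_fst:
  assumes "open S" "separately_holomorphic_on F S"
  shows "separately_holomorphic_on (deriv_fst F) S"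
proof -
  have "(\<lambda>v. deriv_fst F (v, \<tau>\<^sub>0)) field_differentiable (at w\<^sub>0) \<and>
      (\<lambda>\<sigma>. deriv_fst F (w\<^sub>0, \<sigma>)) field_differentiable (at \<tau>\<^sub>0)" if S: "(w\<^sub>0, \<tau>\<^sub>0) \<in> S" for w\<^sub>0 \<tau>\<^sub>0
  proof
    obtain r where r: "r > 0" "\<And>w \<tau> u. w \<in> ball w\<^sub>0 r \<Longrightarrow> \<tau> \<in> ball \<tau>\<^sub>0 r \<Longrightarrow> u \<in> cball w r \<Longrightarrow> (u, \<tau>) \<in> S"
      "\<And>w \<tau>. w \<in> ball w\<^sub>0 r \<Longrightarrow> \<tau> \<in> ball \<tau>\<^sub>0 r \<Longrightarrow> deriv_fst F (w, \<tau>) =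
        integral (cbox 0 1) (\<lambda>t::real. F (w + circle_vec r t, \<tau>) /
          circle_vec r t)"
      using deriv_fst_local_integral[OF assms S] by blast
    have w0: "w\<^sub>0 \<in> ball w\<^sub>0 r" and \<tau>0: "\<tau>\<^sub>0 \<in> ball \<tau>\<^sub>0 r" using r(1) by auto
    have "(\<lambda>v. F (v, \<tau>\<^sub>0)) holomorphic_on ball w\<^sub>0 r"
      unfolding holomorphic_on_def
    proof
      fix v assume v: "v \<in> ball w\<^sub>0 r"
      have "(v, \<tau>\<^sub>0) \<in> S" by (rule r(2)[OF v \<tau>0]) (use r(1) in simp)
      then show "(\<lambda>v. F (v, \<tau>\<^sub>0)) field_differentiable (at v within ball w\<^sub>0 r)"
        by (rule field_differentiable_at_within[OF separately_holomorphic_onD(2)[OF assms(2)]])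
    qed
    then have "deriv (\<lambda>v. F (v, \<tau>\<^sub>0)) holomorphic_on ball w\<^sub>0 r"
      by (rule holomorphic_deriv) simp
    then show "(\<lambda>v. deriv_fst F (v, \<tau>\<^sub>0)) field_differentiable (at w\<^sub>0)"
      using holomorphic_on_imp_differentiable_at[OF _ open_ball w0] by (simp add: deriv_fst_def)
    have "(\<lambda>\<sigma>. integral (cbox 0 1) (\<lambda>t::real. F (w\<^sub>0 + circle_vec r t, \<sigma>) / circle_vec r t))
        holomorphic_on ball \<tau>\<^sub>0 r"
    proof (rule leibniz_rule_holomorphic)
      fix \<sigma> :: complex and t :: real assume \<sigma>: "\<sigma> \<in> ball \<tau>\<^sub>0 r"
      have mem: "(w\<^sub>0 + circle_vec r t, \<sigma>) \<in> S"
        using r(2)[OF w0 \<sigma> circle_point_mem[OF r(1)]] .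
      then have "((\<lambda>\<sigma>. F (w\<^sub>0 + circle_vec r t, \<sigma>)) has_field_derivative deriv_snd F (w\<^sub>0
          + circle_vec r t, \<sigma>)) (at \<sigma>)"
        unfolding deriv_snd_def prod.case
        by (intro field_differentiable_derivI separately_holomorphic_onD(3)[OF assms(2)])
      then show "((\<lambda>\<sigma>. F (w\<^sub>0 + circle_vec r t, \<sigma>) / circle_vec r t)
          has_field_derivative deriv_snd F (w\<^sub>0 + circle_vec r t, \<sigma>) / circle_vec r t)
              (at \<sigma> within ball \<tau>\<^sub>0 r)"
        by (rule has_field_derivative_at_within[OF DERIV_cdivide])
    next
      have *: "continuous_on (ball \<tau>\<^sub>0 r \<times> cbox 0 1) (\<lambda>(\<sigma>, t). G (w\<^sub>0 + circle_vec r t, \<sigma>)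
          / circle_vec r t)"
        if "continuous_on S G" for G
      proof -
        have "continuous_on (({w\<^sub>0} \<times> ball \<tau>\<^sub>0 r) \<times> cbox 0 1) (\<lambda>(p, t). G (fst p
            + circle_vec r t, snd p) / circle_vec r t)"
          using r(2)[OF w0] by (intro continuous_on_circle_integrand[OF that r(1)]) auto
        then have "continuous_on (ball \<tau>\<^sub>0 r \<times> cbox 0 1)
          (\<lambda>x. (\<lambda>(p, t). G (fst p + circle_vec r t, snd p) / circle_vec r t) ((w\<^sub>0, fst x), snd x))"
          by (rule continuous_on_compose2) (auto intro!: continuous_intros)
        then show ?thesis by (simp add: case_prod_beta)
      qed
      show "continuous_on (ball \<tau>\<^sub>0 r \<times> cbox 0 1) (\<lambda>(\<sigma>, t). deriv_snd F (w\<^sub>0 + circle_vec r t, \<sigma>)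
          / circle_vec r t)"
        by (rule *) (rule continuous_on_deriv_snd[OF assms])
      fix \<sigma> assume \<sigma>: "\<sigma> \<in> ball \<tau>\<^sub>0 r"
      have "continuous_on (ball \<tau>\<^sub>0 r \<times> cbox 0 1) (\<lambda>(\<sigma>, t). F (w\<^sub>0 + circle_vec r t, \<sigma>)
          / circle_vec r t)"
        by (rule *) (use assms(2) in \<open>simp add: separately_holomorphic_on_def\<close>)
      then have "continuous_on (cbox 0 1) (\<lambda>t. (\<lambda>(\<sigma>, t). F (w\<^sub>0 + circle_vec r t, \<sigma>)
          / circle_vec r t) (\<sigma>, t))"
        by (rule continuous_on_compose2) (use \<sigma> in \<open>auto intro!: continuous_intros\<close>)
      then show "(\<lambda>t. F (w\<^sub>0 + circle_vec r t, \<sigma>) / circle_vec r t) integrable_on cbox 0 1"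
        by (intro integrable_continuous) simp
    qed (rule convex_ball)
    then have "(\<lambda>\<sigma>. deriv_fst F (w\<^sub>0, \<sigma>)) holomorphic_on ball \<tau>\<^sub>0 r"
      by (rule holomorphic_transform) (use r(3)[OF w0] in simp)
    then show "(\<lambda>\<sigma>. deriv_fst F (w\<^sub>0, \<sigma>)) field_differentiable (at \<tau>\<^sub>0)"
      using holomorphic_on_imp_differentiable_at[OF _ open_ball \<tau>0] by blast
  qed
  then show ?thesis
    using continuous_on_deriv_fst[OF assms] by (auto simp: separately_holomorphic_on_def)
qed

lemma separately_holomorphic_deriv_snd:
  assumes "open S" "separately_holomorphic_on F S"
  shows "separately_holomorphic_on (deriv_snd F) S"
proof -
  have "separately_holomorphic_on (deriv_fst (F \<circ> prod.swap)) (prod.swap ` S)"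
    by (intro separately_holomorphic_deriv_fst separately_holomorphic_swap assms open_swap_image)
  from separately_holomorphic_swap[OF this] show ?thesis
    unfolding deriv_snd_eq_swap by (simp add: image_image)
qed

text \<open>Continuity of one partial derivative is enough for total differentiability.\<close>
lemma separately_holomorphic_has_derivative:
  assumes "open S" "separately_holomorphic_on F S" "p \<in> S"
  shows "(F has_derivative (\<lambda>(u, v). deriv_fst F p * u + deriv_snd F p * v)) (at p)"
proof -
  obtain w \<tau> where p: "p = (w, \<tau>)" by (cases p)
  obtain A B where "open A" "open B" "p \<in> A \<times> B" "A \<times> B \<subseteq> S"
    by (rule open_prod_elim[OF assms(1,3)])
  then have AB: "open A" "open B" "w \<in> A" "\<tau> \<in> B" "A \<times> B \<subseteq> S" by (auto simp: p)
  obtain b where b: "b > 0" "ball \<tau> b \<subseteq> B" using AB by (meson open_contains_ball)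
  let ?U = "A \<times> ball \<tau> b"
  have U: "?U \<subseteq> S" "open ?U" using AB b by (auto intro: open_Times)
  have "((\<lambda>(v, \<sigma>). F (v, \<sigma>)) has_derivative
      (\<lambda>(tu, tv). deriv_fst F (w, \<tau>) * tu + blinfun_mult_right (deriv_snd F (w, \<tau>)) tv))
          (at (w, \<tau>) within ?U)"
  proof (rule has_derivative_partialsI)
    show "((\<lambda>v. F (v, \<tau>)) has_derivative (*) (deriv_fst F (w, \<tau>))) (at w within A)"
    proof (rule has_derivative_at_withinI)
      show "((\<lambda>v. F (v, \<tau>)) has_derivative (*) (deriv_fst F (w, \<tau>))) (at w)"
        using assms
        by (auto simp: p deriv_fst_def field_differentiable_derivI separately_holomorphic_onD(2) simp
            flip: has_field_derivative_def)
    qed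
    show "((\<lambda>\<sigma>. F (v, \<sigma>)) has_derivative blinfun_apply (blinfun_mult_right (deriv_snd F (v, \<sigma>))))
        (at \<sigma> within ball \<tau> b)"
      if "v \<in> A" "\<sigma> \<in> ball \<tau> b" for v \<sigma>
    proof (rule has_derivative_at_withinI)
      have "(v, \<sigma>) \<in> S" using that U by auto
      then show "((\<lambda>\<sigma>. F (v, \<sigma>)) has_derivative blinfun_apply (blinfun_mult_right (deriv_snd F (v,
          \<sigma>)))) (at \<sigma>)"
        using assms(2)
        by (auto simp: deriv_snd_def field_differentiable_derivI separately_holomorphic_onD(3) simp
            flip: has_field_derivative_def)
    qed
    have "continuous (at (w, \<tau>)) (deriv_snd F)"
      using continuous_on_deriv_snd[OF assms(1,2)] assms(1,3)
          by (simp add: continuous_on_eq_continuous_at p)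
    then have "continuous (at (w, \<tau>) within ?U) (\<lambda>x. blinfun_mult_right (deriv_snd F x))"
      by (rule bounded_linear.continuous[OF bounded_linear_blinfun_mult_right
          continuous_at_imp_continuous_at_within])
    then show "continuous (at (w, \<tau>) within ?U) (\<lambda>(v, \<sigma>). blinfun_mult_right (deriv_snd F (v, \<sigma>)))"
      unfolding case_prod_beta prod.collapse .
  qed (use b in auto)
  moreover have "at (w, \<tau>) within ?U = at (w, \<tau>)"
    using U AB b by (intro at_within_open) auto
  ultimately show ?thesis by (simp add: p case_prod_beta)
qed

text \<open>By induction on the order: by the chain rule, a directional derivative of the composite is a
  linear combination, with constant coefficients, of two composites of the same form, built from
  the partial derivatives of \<open>F\<close>.\<close>
lemma n_times_differentiable_on_separately_holomorphic:
  fixes A B :: "'a::real_normed_vector \<Rightarrow> complex"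
  assumes "open S" "separately_holomorphic_on F S"
    and A: "\<And>x. (A has_derivative A') (at x)" and B: "\<And>x. (B has_derivative B') (at x)"
    and "\<And>x. (A x, B x) \<in> S"
  shows "n_times_differentiable_on n UNIV (\<lambda>x. F (A x, B x))"
  using assms(2)
proof (induction n arbitrary: F)
  case 0
  have "continuous_on UNIV A" "continuous_on UNIV B"
    using A B by (auto intro!: continuous_at_imp_continuous_on has_derivative_continuous)
  then have "continuous_on UNIV (\<lambda>x. (A x, B x))" by (intro continuous_intros)
  then have "continuous_on UNIV (\<lambda>x. F (A x, B x))"
    by (rule continuous_on_compose2[OF separately_holomorphic_onD(1)[OF 0]]) (use assms(5) in auto)
  then show ?case by simp
next
  case (Suc n)
  have D: "((\<lambda>x. F (A x, B x)) has_derivative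
      (\<lambda>v. deriv_fst F (A x, B x) * A' v + deriv_snd F (A x, B x) * B' v)) (at x)" for x
    using diff_chain_at[OF has_derivative_Pair[OF A B]
      separately_holomorphic_has_derivative[OF assms(1) Suc.prems assms(5)], of x]
    by (simp add: o_def)
  have "n_times_differentiable_on n UNIV (\<lambda>x. deriv_fst F (A x, B x) * A' v + deriv_snd F (A x, B x)
      * B' v)" for v
    by (intro n_times_differentiable_on_add n_times_differentiable_on_mult
        n_times_differentiable_on_const
      Suc.IH separately_holomorphic_deriv_fst separately_holomorphic_deriv_snd assms(1) Suc.prems
          open_UNIV)
  then show ?case
    using D frechet_derivative_at[OF D, symmetric] by (auto simp: differentiable_def)
qed

section \<open>Embeddings of the Kodaira--Thurston manifold by sections\<close>

lemma kt_group_powers: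
  assumes add: "\<And>i j :: int. f i \<circ> f j = f (i + j)" and "f 0 = id" "f 1 \<in> kt_group" "f (- 1) \<in> kt_group"
  shows "f i \<in> kt_group"
proof (induction i rule: int_induct[where k = 0])
  case base then show ?case using assms(2) kt_group_id by metis
next
  case (step1 i) then show ?case using kt_group_comp[OF step1(2) assms(3)] add by simp
next
  case (step2 i) then show ?case using kt_group_comp[OF step2(2) assms(4)] add by simp
qed

lemma kt_map_in_kt_group: "kt_map m n l q \<in> kt_group"
proof -
  have gen: "kt_map 1 0 0 0 \<in> kt_group" "kt_map 0 1 0 0 \<in> kt_group" "kt_map 0 0 1 0 \<in> kt_group"
      "kt_map 0 0 0 1 \<in> kt_group"
    unfolding kt_group_def by (intro generate.incl; simp add: kt_gens)+
  have a: "kt_map m 0 0 0 \<in> kt_group"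
    by (rule kt_group_powers[where f = "\<lambda>m. kt_map m 0 0 0"])
        (use gen kt_group_inverse[OF gen(1)] in \<open>simp_all add: kt_map_comp kt_map_0\<close>)
  have b: "kt_map 0 n 0 0 \<in> kt_group"
    by (rule kt_group_powers[where f = "\<lambda>n. kt_map 0 n 0 0"])
        (use gen kt_group_inverse[OF gen(2)] in \<open>simp_all add: kt_map_comp kt_map_0\<close>)
  have c: "kt_map 0 0 l 0 \<in> kt_group"
    by (rule kt_group_powers[where f = "\<lambda>l. kt_map 0 0 l 0"])
        (use gen kt_group_inverse[OF gen(3)] in \<open>simp_all add: kt_map_comp kt_map_0\<close>)
  have d: "kt_map 0 0 0 q \<in> kt_group"
    by (rule kt_group_powers[where f = "\<lambda>q. kt_map 0 0 0 q"])
        (use gen kt_group_inverse[OF gen(4)] in \<open>simp_all add: kt_map_comp kt_map_0\<close>)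
  have "kt_map m n l q = kt_map 0 n 0 0 \<circ> kt_map m 0 0 0 \<circ> (kt_map 0 0 l 0 \<circ> kt_map 0 0 0 q)"
    by (simp add: kt_map_comp)
  then show ?thesis using a b c d by (simp add: kt_group_comp)
qed

text \<open>The unit cube contains a representative of each orbit: first \<open>x\<close>, \<open>y\<close> and \<open>t\<close> are reduced,
  and then \<open>z\<close>, which the reduction of \<open>x\<close> has changed by a multiple of \<open>y\<close>.\<close>
lemma compact_space_kt_top: "compact_space kt_top"
proof -
  let ?K = "cbox (0, 0, 0, 0) (1, 1, 1, 1) :: r4 set"
  have "compactin kt_top (kt_proj ` ?K)"
    by (rule image_compactin[OF _ quotient_imp_continuous_map[OF quotient_map_kt_proj]])
      (simp add: compact_cbox)
  moreover have "kt_proj ` ?K = topspace kt_top"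
  proof -
    have "kt_proj u \<in> kt_proj ` ?K" for u
    proof -
      obtain x y z t where u: "u = (x, y, z, t)" by (cases u)
      define v where "v = kt_map (- \<lfloor>x\<rfloor>) (- \<lfloor>y\<rfloor>) (- \<lfloor>z - \<lfloor>x\<rfloor> * y\<rfloor>) (- \<lfloor>t\<rfloor>) u"
      have frac: "0 \<le> r - of_int \<lfloor>r\<rfloor>" "r - of_int \<lfloor>r\<rfloor> \<le> 1" for r :: real by linarith+
      have "v = (x - \<lfloor>x\<rfloor>, y - \<lfloor>y\<rfloor>, (z - \<lfloor>x\<rfloor> * y) - \<lfloor>z - \<lfloor>x\<rfloor> * y\<rfloor>, t - \<lfloor>t\<rfloor>)"
        by (simp add: v_def u kt_map_def)
      then have "v \<in> ?K" using frac by (simp add: cbox_Pair_eq)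
      moreover have "kt_proj u = kt_proj v"
        unfolding kt_proj_eq_iff v_def using kt_map_in_kt_group by blast
      ultimately show ?thesis by blast
    qed
    then show ?thesis by (auto simp: kt_top_def)
  qed
  ultimately show ?thesis by (simp add: compact_space_def)
qed

text \<open>The matrix of the orthogonal projection onto the complex line spanned by \<open>z\<close>.\<close>
definition line_projector :: "complex ^ 'n::finite \<Rightarrow> complex ^ 'n ^ 'n"
  where "line_projector z = (\<chi> i j. z $ i * cnj (z $ j) / (\<Sum>l\<in>UNIV. z $ l * cnj (z $ l)))"

lemma hermitian_square_nonzero:
  assumes "z \<noteq> 0" shows "(\<Sum>l\<in>UNIV. z $ l * cnj (z $ l)) \<noteq> (0::complex)"
proof -
  have "(\<Sum>l\<in>UNIV. z $ l * cnj (z $ l)) = of_real (\<Sum>l\<in>UNIV. (norm (z $ l))\<^sup>2)"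
    by (simp add: complex_norm_square del: of_real_power)
  moreover have "(\<Sum>l\<in>UNIV. (norm (z $ l))\<^sup>2) \<noteq> 0"
    using assms by (simp add: sum_nonneg_eq_0_iff vec_eq_iff)
  ultimately show ?thesis by (simp only: of_real_eq_0_iff not_False_eq_True)
qed

lemma line_projector_scale:
  assumes "c \<noteq> 0" shows "line_projector (c *s z) = line_projector z"
proof -
  have "(\<Sum>l\<in>UNIV. (c * z $ l) * cnj (c * z $ l)) = (c * cnj c) * (\<Sum>l\<in>UNIV. z $ l * cnj (z $ l))"
    by (simp add: sum_distrib_left mult_ac)
  then show ?thesis using assms
    by (simp add: line_projector_def vec_eq_iff)
qed

lemma line_projector_inject:
  assumes "z \<noteq> 0" "w \<noteq> 0" "line_projector z = line_projector w"
  shows "cp_point z = cp_point w"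
proof -
  define a where "a = (\<Sum>l\<in>UNIV. z $ l * cnj (z $ l))"
  define b where "b = (\<Sum>l\<in>UNIV. w $ l * cnj (w $ l))"
  have ab: "a \<noteq> 0" "b \<noteq> 0" using assms hermitian_square_nonzero by (auto simp: a_def b_def)
  have eq: "z $ i * cnj (z $ j) / a = w $ i * cnj (w $ j) / b" for i j
    using arg_cong[OF assms(3), of "\<lambda>M. M $ i $ j"] by (simp add: line_projector_def a_def b_def)
  obtain j where j: "z $ j \<noteq> 0" using assms(1) by (auto simp: vec_eq_iff)
  then have wj: "w $ j \<noteq> 0" using eq[of j j] ab by auto
  define c where "c = b * cnj (z $ j) / (a * cnj (w $ j))"
  have "w $ i = c * z $ i" for i
  proof -
    have "y = (b * p / (a * q)) * x" if "x * p / a = y * q / b" "q \<noteq> 0" for x y p q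
      using that ab by (simp add: field_simps)
    from this[OF eq[of i j]] show ?thesis using wj by (simp add: c_def)
  qed
  then have "w = c *s z"
    by (simp add: vec_eq_iff)
  moreover have "c \<noteq> 0"
    using ab j wj by (simp add: c_def)
  ultimately show ?thesis unfolding cp_point_eq_iff by blast
qed

text \<open>A line is determined by the orthogonal projection onto it, and the projection depends
  continuously on the line. This embeds projective space continuously in a space of matrices.\<close>
lemma Hausdorff_space_cp_top: "Hausdorff_space (cp_top :: (complex ^ 'm::finite option) set topology)"
proof -
  define h where "h = (\<lambda>L :: (complex ^ 'm option) set. line_projector (SOME z. z \<in> L))"
  have h: "h (cp_point z) = line_projector z" for z
  proof -
    have "z \<in> cp_point z" by (auto simp: cp_point_def intro!: exI[of _ 1])
    then have "(SOME x. x \<in> cp_point z) \<in> cp_point z" by (rule someI)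
    then obtain c where "c \<noteq> 0" "(SOME x. x \<in> cp_point z) = c *s z" by (auto simp: cp_point_def)
    then show ?thesis by (simp add: h_def line_projector_scale)
  qed
  show ?thesis
  proof (rule Hausdorff_space_injective_preimage)
    show "Hausdorff_space (euclidean :: (complex ^ 'm option ^ 'm option) topology)"
      by (rule Hausdorff_space_euclidean)
    have "continuous_on (UNIV - {0}) (line_projector :: complex ^ 'm option \<Rightarrow> _)"
      unfolding line_projector_def[abs_def]
      by (intro continuous_on_vec_lambda continuous_intros) (use hermitian_square_nonzero in auto)
    then show "continuous_map cp_top euclidean h"
      unfolding continuous_compose_quotient_map_eq[OF quotient_map_cp_point, symmetric]
      by (simp add: o_def h)
    show "inj_on h (topspace cp_top)"
      using line_projector_inject by (auto simp: inj_on_def cp_top_def h)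
  qed
qed

text \<open>The general criterion: sections of a line bundle over the quotient, seen as functions on
  \<^typ>\<open>r4\<close> with a common multiplier, define an embedding if they have no common zero and separate
  points and tangent vectors. In an affine chart the map is given by the quotients \<open>s i / s j\<close>.
  Their derivatives along \<open>v\<close> all vanish if and only if the derivative of each \<open>s i\<close> along \<open>v\<close> is
  \<open>s i\<close> times the logarithmic derivative of \<open>s j\<close>, which the last hypothesis excludes for \<open>v \<noteq> 0\<close>.
  For each fixed factor \<open>c\<close> the premises of the last two hypotheses are linear conditions on the
  sections.\<close>
lemma smooth_embedding_by_sections:
  fixes s :: "'m::finite option \<Rightarrow> r4 \<Rightarrow> complex"
  assumes smooth: "\<And>i n. n_times_differentiable_on n UNIV (s i)"
    and base_point_free: "\<And>u. \<exists>i. s i u \<noteq> 0"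
    and equivariant: "\<And>g u. g \<in> kt_group \<Longrightarrow> \<exists>c. c \<noteq> 0 \<and> (\<forall>i. s i (g u) = c * s i u)"
    and separates_points: "\<And>u v c. \<forall>i. s i v = c * s i u \<Longrightarrow> \<exists>g\<in>kt_group. v = g u"
    and separates_tangents: "\<And>u v c. \<forall>i. frechet_derivative (s i) (at u) v = c * s i u \<Longrightarrow> v = 0"
  shows "\<exists>\<phi>. (\<forall>u. \<phi> (kt_proj u) = cp_point (\<chi> i. s i u)) \<and>
    smooth_embedding kt_top kt_atlas cp_top cp_atlas \<phi>"
proof -
  define \<sigma> where "\<sigma> u = (\<chi> i. s i u)" for u
  have \<sigma>_nonzero: "\<sigma> u \<noteq> 0" for u
    using base_point_free[of u] by (auto simp: \<sigma>_def vec_eq_iff)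
  define \<phi> where "\<phi> P = cp_point (\<sigma> (SOME u. kt_proj u = P))" for P
  have \<phi>: "\<phi> (kt_proj u) = cp_point (\<sigma> u)" for u
  proof -
    have "kt_proj (SOME v. kt_proj v = kt_proj u) = kt_proj u" by (rule someI) (rule refl)
    then obtain g where "g \<in> kt_group" "u = g (SOME v. kt_proj v = kt_proj u)"
      unfolding kt_proj_eq_iff by blast
    then obtain c where "c \<noteq> 0" "\<forall>i. s i u = c * s i (SOME v. kt_proj v = kt_proj u)"
      using equivariant by metis
    then show ?thesis
      unfolding \<phi>_def cp_point_eq_iff by (intro exI[of _ c]) (simp add: \<sigma>_def vec_eq_iff)
  qed
  have diff: "s i differentiable (at u)" for i u
    using smooth[of "Suc 0" i] unfolding n_times_differentiable_on.simps(2) by blast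
  have "continuous_on UNIV (s i)" for i using smooth[of 0 i] by simp
  then have "continuous_on UNIV \<sigma>"
    unfolding \<sigma>_def by (intro continuous_on_vec_lambda)
  then have "continuous_map euclidean (top_of_set (UNIV - {0})) \<sigma>"
    using \<sigma>_nonzero by (simp add: continuous_map_in_subtopology image_subset_iff)
  then have "continuous_map euclidean cp_top (cp_point \<circ> \<sigma>)"
    by (rule continuous_map_compose) (rule quotient_imp_continuous_map[OF quotient_map_cp_point])
  then have cont: "continuous_map kt_top cp_top \<phi>"
    unfolding continuous_compose_quotient_map_eq[OF quotient_map_kt_proj, symmetric]
    by (simp add: o_def \<phi>)
  have inj: "inj_on \<phi> (topspace kt_top)"
  proof (rule inj_onI)
    fix P Q assume "P \<in> topspace kt_top" "Q \<in> topspace kt_top" and eq: "\<phi> P = \<phi> Q"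
    then obtain u v where uv: "P = kt_proj u" "Q = kt_proj v" by (auto simp: kt_top_def)
    then obtain c where "\<sigma> v = c *s \<sigma> u" using eq by (auto simp: \<phi> cp_point_eq_iff)
    then have "\<forall>i. s i v = c * s i u" by (simp add: \<sigma>_def vec_eq_iff)
    then show "P = Q" unfolding uv kt_proj_eq_iff by (rule separates_points)
  qed
  have chart_image: "inv_into V kt_proj ` (kt_proj ` V \<inter> \<phi> -` (cp_point ` {z. z $ j \<noteq> 0})) = {v
      \<in> V. s j v \<noteq> 0}"
    if "inj_on kt_proj V" for V j
  proof (intro equalityI subsetI)
    fix v assume "v \<in> {v \<in> V. s j v \<noteq> 0}"
    then have "v = inv_into V kt_proj (kt_proj v)"
        "kt_proj v \<in> kt_proj ` V \<inter> \<phi> -` (cp_point ` {z. z $ j \<noteq> 0})"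
      using that by (auto simp: \<phi> cp_point_mem_chart_iff \<sigma>_def)
    then show "v \<in> inv_into V kt_proj ` (kt_proj ` V \<inter> \<phi> -` (cp_point ` {z. z $ j \<noteq> 0}))"
        by (rule image_eqI)
  next
    fix v assume "v \<in> inv_into V kt_proj ` (kt_proj ` V \<inter> \<phi> -` (cp_point ` {z. z $ j \<noteq> 0}))"
    then obtain x where x: "x \<in> V" "v = inv_into V kt_proj (kt_proj x)"
        "\<phi> (kt_proj x) \<in> cp_point ` {z. z $ j \<noteq> 0}"
      by blast
    then show "v \<in> {v \<in> V. s j v \<noteq> 0}"
      using that by (simp add: \<phi> cp_point_mem_chart_iff \<sigma>_def)
  qed
  have open_dom: "open {v \<in> V. s j v \<noteq> 0}" if "open V" for V j
  proof -
    have "open {v. s j v \<noteq> 0}"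
      using \<open>\<And>i. continuous_on UNIV (s i)\<close> by (intro open_Collect_neq continuous_on_const)
    then show ?thesis using that by (simp add: open_Int Collect_conj_eq flip: Int_def)
  qed
  have local: "(cp_chart j \<circ> \<phi> \<circ> inv_into (kt_proj ` V) (inv_into V kt_proj)) v
      = (\<chi> i. s (cp_index j i) v / s j v)"
    if "inj_on kt_proj V" "v \<in> V" for V j v
  proof -
    have "inv_into (kt_proj ` V) (inv_into V kt_proj) v = kt_proj v"
      by (rule inv_into_f_eq) (use that in \<open>auto intro!: inj_on_inv_into\<close>)
    then show ?thesis by (simp add: \<phi> cp_chart_cp_point \<sigma>_def)
  qed
  have smooth_quot: "n_times_differentiable_on n {v \<in> V. s j v \<noteq> 0} (\<lambda>v. \<chi> i. s (cp_index j i) v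
      / s j v)"
    if "open V" for n V j
  proof (rule n_times_differentiable_on_vec[OF open_dom[OF that]])
    fix i
    have "n_times_differentiable_on n {v \<in> V. s j v \<noteq> 0} (\<lambda>v. s (cp_index j i) v * inverse (s j v))"
      by (intro n_times_differentiable_on_mult n_times_differentiable_on_inverse open_dom that
        n_times_differentiable_on_subset[OF subset_UNIV smooth]) auto
    then show "n_times_differentiable_on n {v \<in> V. s j v \<noteq> 0} (\<lambda>v. (\<chi> i. s (cp_index j i) v
        / s j v) $ i)"
      by (simp add: divide_inverse)
  qed
  have "smooth_map kt_top kt_atlas cp_top cp_atlas \<phi>"
    unfolding smooth_map_def
  proof (intro conjI cont ballI, clarify)
    fix D \<psi> and E :: "(complex ^ 'm option) set set" and \<eta> :: "(complex ^ 'm option) set \<Rightarrow> complex ^ 'm"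
    assume "(D, \<psi>) \<in> kt_atlas" "(E, \<eta>) \<in> cp_atlas"
    then obtain V j where V: "open V" "inj_on kt_proj V" "D = kt_proj ` V" "\<psi> = inv_into V kt_proj"
      and j: "E = cp_point ` {z. z $ j \<noteq> 0}" "\<eta> = cp_chart j"
      by (auto simp: kt_atlas_def cp_atlas_def)
    show "smooth_on (\<psi> ` (D \<inter> \<phi> -` E)) (\<eta> \<circ> \<phi> \<circ> inv_into D \<psi>)"
      unfolding V(3,4) j chart_image[OF V(2)] smooth_on_def
      by (intro allI n_times_differentiable_on_cong[OF open_dom[OF V(1)] _ smooth_quot[OF V(1)]])
        (use local[OF V(2)] in simp)
  qed
  moreover have "inj (frechet_derivative (\<eta> \<circ> \<phi> \<circ> inv_into D \<psi>) (at (\<psi> x)))"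
    if charts: "(D, \<psi>) \<in> kt_atlas" "(E, \<eta>) \<in> cp_atlas" and x: "x \<in> D \<inter> \<phi> -` E" for D \<psi> x
      and E :: "(complex ^ 'm option) set set" and \<eta> :: "(complex ^ 'm option) set \<Rightarrow> complex ^ 'm"
  proof -
    obtain V j where V: "open V" "inj_on kt_proj V" "D = kt_proj ` V" "\<psi> = inv_into V kt_proj"
      and j: "E = cp_point ` {z. z $ j \<noteq> 0}" "\<eta> = cp_chart j"
      using charts by (auto simp: kt_atlas_def cp_atlas_def)
    define u where "u = \<psi> x"
    have "u \<in> \<psi> ` (D \<inter> \<phi> -` E)" using x by (simp add: u_def)
    then have u: "u \<in> V" "s j u \<noteq> 0" unfolding V(3,4) j chart_image[OF V(2)] by auto
    let ?Q = "\<lambda>v. \<chi> i. s (cp_index j i) v / s j v"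
    let ?d = "\<lambda>i. frechet_derivative (s i) (at u)"
    have "?Q differentiable (at u)"
      using smooth_quot[OF V(1), of "Suc 0" j] u unfolding n_times_differentiable_on.simps(2) by blast
    then have "((\<lambda>v. \<chi> i. s (cp_index j i) v / s j v) has_derivative frechet_derivative ?Q (at u))
        (at u)"
      by (simp add: frechet_derivative_works)
    then have Q: "((\<eta> \<circ> \<phi> \<circ> inv_into D \<psi>) has_derivative frechet_derivative ?Q (at u)) (at u)"
      by (rule has_derivative_transform_within_open[OF _ open_dom[OF V(1), of j]])
        (use u local[OF V(2)] in \<open>auto simp: V(3,4) j\<close>)
    have lin: "linear (frechet_derivative ?Q (at u))"
      using \<open>?Q differentiable (at u)\<close> by (rule linear_frechet_derivative)
    have "v = 0" if zero: "frechet_derivative ?Q (at u) v = 0" for v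
    proof (rule separates_tangents, rule allI)
      fix i
      show "?d i v = (?d j v / s j u) * s i u"
      proof (cases "i = j")
        case False
        define i' where "i' = cp_index_inv j i"
        have i: "i = cp_index j i'" using False by (simp add: i'_def)
        have "((\<lambda>v. ?Q v $ i') has_derivative (\<lambda>v. frechet_derivative ?Q (at u) v $ i')) (at u)"
          using \<open>?Q differentiable (at u)\<close>
          by (intro bounded_linear.has_derivative[OF bounded_linear_vec_nth]) (simp
              add: frechet_derivative_works)
        then have 1: "((\<lambda>v. s i v / s j v) has_derivative (\<lambda>v. frechet_derivative ?Q (at u) v $ i'))
            (at u)"
          by (simp add: i)
        have "(s i has_derivative ?d i) (at u)" "(s j has_derivative ?d j) (at u)"
          using diff by (simp_all add: frechet_derivative_works)
        from has_derivative_divide'[OF this u(2)]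
        have "((\<lambda>v. s i v / s j v) has_derivative (\<lambda>h. (?d i h * s j u - s i u * ?d j h) / (s j u
            * s j u))) (at u)" .
        from fun_cong[OF has_derivative_unique[OF 1 this], of v]
        have "(?d i v * s j u - s i u * ?d j v) / (s j u * s j u) = 0"
          by (simp add: zero)
        then have "?d i v * s j u = s i u * ?d j v"
          using u(2) by simp
        then show ?thesis using u(2) by (simp add: field_simps)
      qed (use u(2) in simp)
    qed
    then have "inj (frechet_derivative ?Q (at u))"
      unfolding linear_injective_0[OF lin] by blast
    then show ?thesis
      unfolding u_def[symmetric] frechet_derivative_at[OF Q, symmetric] .
  qed
  ultimately have "immersion kt_top kt_atlas cp_top cp_atlas \<phi>"
    unfolding immersion_def by blast
  moreover have "embedding_map kt_top cp_top \<phi>"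
    using injective_closed_imp_embedding_map[OF cont _ inj]
      T1_Spaces.continuous_imp_closed_map[OF cont compact_space_kt_top Hausdorff_space_cp_top] by blast
  ultimately have "smooth_embedding kt_top kt_atlas cp_top cp_atlas \<phi>"
    using inj by (simp add: smooth_embedding_def)
  then show ?thesis using \<phi> by (auto simp: \<sigma>_def)
qed

section \<open>Linear conditions on function spaces\<close>

text \<open>A linear condition passes from a basis to the space that it spans. Having the value at \<open>v\<close>
  in a given proportion to the value at \<open>u\<close>, having the derivative along \<open>v\<close> in a given proportion
  to the value, and smoothness are such conditions.\<close>
lemma is_basis_subset_subspace:
  assumes "is_basis I b V" "cfun.subspace T" "\<And>i. i \<in> I \<Longrightarrow> b i \<in> T"
  shows "V \<subseteq> T"
  using assms cfun.span_minimal[of "b ` I" T] by (auto simp: is_basis_def)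

lemma is_basis_mem: "is_basis I b V \<Longrightarrow> i \<in> I \<Longrightarrow> b i \<in> V"
  using cfun.span_base[of "b i" "b ` I"] by (auto simp: is_basis_def)

lemma subspace_proportional: "cfun.subspace {f. f v = c * f u}"
  by (auto simp: cfun.subspace_def cfun_scale_def algebra_simps)

lemma subspace_proportional_derivative:
  fixes u v :: "'a::real_normed_vector"
  shows "cfun.subspace {f. \<exists>d. (f has_derivative d) (at u) \<and> d v = c * f u}"
  unfolding cfun.subspace_def
proof (intro conjI ballI allI)
  show "0 \<in> {f. \<exists>d. (f has_derivative d) (at u) \<and> d v = c * f u}"
    by (auto simp: zero_fun_def intro!: exI[of _ "\<lambda>_. 0"])
next
  fix f g assume "f \<in> {f. \<exists>d. (f has_derivative d) (at u) \<and> d v = c * f u}"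
    "g \<in> {f. \<exists>d. (f has_derivative d) (at u) \<and> d v = c * f u}"
  then obtain d e where "(f has_derivative d) (at u)" "d v = c * f u" "(g has_derivative e) (at u)"
      "e v = c * g u"
    by blast
  then show "f + g \<in> {f. \<exists>d. (f has_derivative d) (at u) \<and> d v = c * f u}"
    by (auto simp: plus_fun_def ring_distribs intro!: exI[of _ "\<lambda>h. d h + e h"] has_derivative_add)
next
  fix a f assume "f \<in> {f. \<exists>d. (f has_derivative d) (at u) \<and> d v = c * f u}"
  then obtain d where "(f has_derivative d) (at u)" "d v = c * f u" by blast
  then show "cfun_scale a f \<in> {f. \<exists>d. (f has_derivative d) (at u) \<and> d v = c * f u}"
    by (auto simp: cfun_scale_def intro!: exI[of _ "\<lambda>h. a * d h"] has_derivative_mult_right)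
qed

lemma subspace_n_times_differentiable: "cfun.subspace {f. n_times_differentiable_on n UNIV f}"
  using n_times_differentiable_on_const[of n UNIV 0]
  by (auto simp: cfun.subspace_def zero_fun_def plus_fun_def cfun_scale_def
    intro!: n_times_differentiable_on_add n_times_differentiable_on_mult
        n_times_differentiable_on_const)

section \<open>Theta functions on the Kodaira--Thurston manifold\<close>

text \<open>The translations with a common multiplier form a group, which contains \<open>1\<close> and \<open>\<tau>\<close>.\<close>
lemma classical_theta_multiplier:
  "\<exists>c. c \<noteq> 0 \<and> (\<forall>f\<in>classical_theta k \<tau>. f (w + (of_int m + of_int n * \<tau>)) = c * f w)"
proof -
  define G where "G = {\<omega>. \<forall>w. \<exists>c. c \<noteq> 0 \<and> (\<forall>f\<in>classical_theta k \<tau>. f (w + \<omega>) = c * f w)}"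
  have zero: "0 \<in> G" by (auto simp: G_def intro!: exI[of _ 1])
  have add: "\<omega> + \<omega>' \<in> G" if \<omega>: "\<omega> \<in> G" "\<omega>' \<in> G" for \<omega> \<omega>'
    unfolding G_def
  proof (intro CollectI allI)
    fix w
    obtain c where c: "c \<noteq> 0" "\<forall>f\<in>classical_theta k \<tau>. f (w + \<omega>) = c * f w"
      using \<omega>(1) by (auto simp: G_def)
    obtain c' where c': "c' \<noteq> 0" "\<forall>f\<in>classical_theta k \<tau>. f ((w + \<omega>) + \<omega>') = c' * f (w + \<omega>)"
      using \<omega>(2) unfolding G_def by blast
    show "\<exists>c. c \<noteq> 0 \<and> (\<forall>f\<in>classical_theta k \<tau>. f (w + (\<omega> + \<omega>')) = c * f w)"
      using c c' by (intro exI[of _ "c' * c"]) (auto simp: add.assoc)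
  qed
  have minus: "- \<omega> \<in> G" if \<omega>: "\<omega> \<in> G" for \<omega>
    unfolding G_def
  proof (intro CollectI allI)
    fix w
    obtain c where c: "c \<noteq> 0" "\<forall>f\<in>classical_theta k \<tau>. f ((w - \<omega>) + \<omega>) = c * f (w - \<omega>)"
      using \<omega> unfolding G_def by blast
    then show "\<exists>c. c \<noteq> 0 \<and> (\<forall>f\<in>classical_theta k \<tau>. f (w + - \<omega>) = c * f w)"
      by (intro exI[of _ "inverse c"]) (auto simp: field_simps)
  qed
  have mult: "of_int i * \<omega> \<in> G" if \<omega>: "\<omega> \<in> G" for i \<omega>
  proof (induction i rule: int_induct[where k = 0])
    case base then show ?case using zero by simp
  next
    case (step1 i) then show ?case using add[OF step1(2) \<omega>] by (simp add: algebra_simps)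
  next
    case (step2 i) then show ?case using add[OF step2(2) minus[OF \<omega>]] by (simp add: algebra_simps)
  qed
  have "1 \<in> G"
    by (auto simp: G_def classical_theta_def intro!: exI[of _ 1])
  moreover have "\<tau> \<in> G"
    unfolding G_def
  proof (intro CollectI allI)
    fix w show "\<exists>c. c \<noteq> 0 \<and> (\<forall>f\<in>classical_theta k \<tau>. f (w + \<tau>) = c * f w)"
      by (intro exI[of _ "exp (- 2 * of_real pi * \<i> * of_nat k * w)"]) (auto simp: classical_theta_def)
  qed
  ultimately have "of_int m * 1 + of_int n * \<tau> \<in> G" using add mult by blast
  then show ?thesis by (simp add: G_def)
qed

context
  fixes k :: nat and \<theta> :: "nat \<Rightarrow> complex \<Rightarrow> complex \<Rightarrow> complex"
  assumes k: "k \<ge> 3" and fam: "theta_family k \<theta>"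
begin

lemma theta_basis: "Im \<tau> > 0 \<Longrightarrow> is_basis {1..k} (\<lambda>p w. \<theta> p w \<tau>) (classical_theta k \<tau>)"
  using fam by (simp add: theta_family_def)

lemma theta_mem: "Im \<tau> > 0 \<Longrightarrow> p \<in> {1..k} \<Longrightarrow> (\<lambda>w. \<theta> p w \<tau>) \<in> classical_theta k \<tau>"
  using is_basis_mem[OF theta_basis] by blast

lemma theta_base_point_free:
  assumes "Im \<tau> > 0" obtains p where "p \<in> {1..k}" "\<theta> p w \<tau> \<noteq> 0"
proof -
  obtain f where f: "f \<in> classical_theta k \<tau>" "f w \<noteq> 0"
    using classical_theta_no_base_point[OF assms k] by blast
  have "\<exists>p\<in>{1..k}. \<theta> p w \<tau> \<noteq> 0"
  proof (rule ccontr)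
    assume "\<not> (\<exists>p\<in>{1..k}. \<theta> p w \<tau> \<noteq> 0)"
    then have "classical_theta k \<tau> \<subseteq> {f. f w = 0 * f w}"
      by (intro is_basis_subset_subspace[OF theta_basis[OF assms] subspace_proportional]) auto
    then show False using f by auto
  qed
  then show thesis using that by blast
qed

lemma theta_separates_points:
  assumes "Im \<tau> > 0" "\<And>p. p \<in> {1..k} \<Longrightarrow> \<theta> p w' \<tau> = c * \<theta> p w \<tau>"
  shows "w' - w \<in> period_lattice \<tau>"
proof (rule ccontr)
  assume "w' - w \<notin> period_lattice \<tau>"
  then obtain f where f: "f \<in> classical_theta k \<tau>" "f w = 0" "f w' \<noteq> 0"
    using classical_theta_separates[OF assms(1) k] by blast
  have "classical_theta k \<tau> \<subseteq> {f. f w' = c * f w}"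
    using assms by (intro is_basis_subset_subspace[OF theta_basis subspace_proportional]) auto
  then show False using f by auto
qed

lemma theta_has_derivative:
  assumes "Im \<tau> > 0" "p \<in> {1..k}"
  shows "((\<lambda>w. \<theta> p w \<tau>) has_field_derivative deriv (\<lambda>w. \<theta> p w \<tau>) w) (at w)"
  using theta_mem[OF assms] holomorphic_derivI[OF _ open_UNIV] by (auto simp: classical_theta_def)

text \<open>If the condition held for some \<open>\<nu> \<noteq> 0\<close>, then every classical theta function with a zero at
  \<open>w\<close> would have a multiple zero there.\<close>
lemma theta_separates_tangents:
  assumes "Im \<tau> > 0" "\<And>p. p \<in> {1..k} \<Longrightarrow> deriv (\<lambda>w. \<theta> p w \<tau>) w * \<nu> = c * \<theta> p w \<tau>"
  shows "\<nu> = 0"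
proof -
  obtain f d where f: "f \<in> classical_theta k \<tau>" "f w = 0" "(f has_field_derivative d) (at w)" "d \<noteq> 0"
    using classical_theta_simple_zero[OF assms(1) k] by blast
  have "classical_theta k \<tau> \<subseteq> {f. \<exists>d. (f has_derivative d) (at w) \<and> d \<nu> = c * f w}"
  proof (rule is_basis_subset_subspace[OF theta_basis[OF assms(1)] subspace_proportional_derivative])
    fix p assume "p \<in> {1..k}"
    then show "(\<lambda>w. \<theta> p w \<tau>) \<in> {f. \<exists>d. (f has_derivative d) (at w) \<and> d \<nu> = c * f w}"
      using theta_has_derivative[OF assms(1)] assms(2) unfolding has_field_derivative_def by blast
  qed
  then obtain e where "(f has_derivative e) (at w)" "e \<nu> = 0" using f(1,2) by auto
  then have "d * \<nu> = 0"
    using fun_cong[OF has_derivative_unique[OF f(3)[unfolded has_field_derivative_def]], of e \<nu>] by simp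
  then show ?thesis using f(4) by simp
qed

lemma theta_period_modulus:
  assumes "Im \<tau> > 0" "p \<in> {1..k}" shows "\<theta> p w (\<tau> + of_int n) = \<theta> p w \<tau>"
proof -
  have shift: "\<theta> p w (\<sigma> + 1) = \<theta> p w \<sigma>" if "Im \<sigma> > 0" for \<sigma>
    using fam assms(2) that by (simp add: theta_family_def)
  show ?thesis
  proof (induction n rule: int_induct[where k = 0])
    case base then show ?case by simp
  next
    case (step1 i) then show ?case using shift[of "\<tau> + of_int i"] assms(1) by (simp add: add.assoc)
  next
    case (step2 i) then show ?case using shift[of "\<tau> + of_int (i - 1)"] assms(1)
        by (simp add: algebra_simps)
  qed
qed

text \<open>In the variables \<open>w = z + \<i> * x\<close>, \<open>\<tau> = y + \<i>\<close> and \<open>v = y + \<i> * t\<close> the group acts by lattice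
  translations: \<open>w\<close> moves by \<open>l + m * \<tau>\<close>, because \<open>x\<close> grows by \<open>m\<close> and \<open>z\<close> by \<open>l + m * y\<close>; \<open>v\<close>
  moves by \<open>n + r * \<i>\<close>; and \<open>\<tau>\<close> moves by \<open>n\<close>, a period of the family.\<close>
lemma kt_theta_multiplier:
  "\<exists>c. c \<noteq> 0 \<and> (\<forall>p\<in>{1..k}. \<forall>q\<in>{1..k}. kt_theta \<theta> p q (kt_map m n l r u) = c * kt_theta \<theta> p q u)"
proof -
  obtain x y z t where u: "u = (x, y, z, t)" by (cases u)
  define \<tau> where "\<tau> = of_real y + \<i>"
  have Im: "Im \<tau> > 0" "Im \<i> > 0" by (simp_all add: \<tau>_def)
  define w where "w = of_real z + \<i> * of_real x"
  define v where "v = of_real y + \<i> * of_real t"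
  obtain c where c: "c \<noteq> 0" "\<forall>f\<in>classical_theta k \<tau>. f (w + (of_int l + of_int m * \<tau>)) = c * f w"
    using classical_theta_multiplier by blast
  obtain d where d: "d \<noteq> 0" "\<forall>f\<in>classical_theta k \<i>. f (v + (of_int n + of_int r * \<i>)) = d * f v"
    using classical_theta_multiplier by blast
  have "kt_theta \<theta> p q (kt_map m n l r u) = (c * d) * kt_theta \<theta> p q u"
      if pq: "p \<in> {1..k}" "q \<in> {1..k}" for p q
  proof -
    have "kt_theta \<theta> p q (kt_map m n l r u) =
        \<theta> p (w + (of_int l + of_int m * \<tau>)) (\<tau> + of_int n) * \<theta> q (v + (of_int n + of_int r * \<i>)) \<i>"
      by (simp add: kt_theta_def kt_map_def u w_def v_def \<tau>_def algebra_simps)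
    also have "\<dots> = (c * \<theta> p w \<tau>) * (d * \<theta> q v \<i>)"
      using bspec[OF c(2) theta_mem[OF Im(1) pq(1)]] bspec[OF d(2) theta_mem[OF Im(2) pq(2)]]
      by (simp only: theta_period_modulus[OF Im(1) pq(1)])
    also have "\<dots> = (c * d) * kt_theta \<theta> p q u"
      by (simp add: kt_theta_def u w_def v_def \<tau>_def)
    finally show ?thesis .
  qed
  then show ?thesis using c(1) d(1) by (intro exI[of _ "c * d"]) simp
qed

lemma kt_theta_base_point_free: "\<exists>p\<in>{1..k}. \<exists>q\<in>{1..k}. kt_theta \<theta> p q u \<noteq> 0"
proof -
  obtain x y z t where u: "u = (x, y, z, t)" by (cases u)
  obtain p where "p \<in> {1..k}" "\<theta> p (of_real z + \<i> * of_real x) (of_real y + \<i>) \<noteq> 0"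
    by (rule theta_base_point_free[of "of_real y + \<i>"]) auto
  moreover obtain q where "q \<in> {1..k}" "\<theta> q (of_real y + \<i> * of_real t) \<i> \<noteq> 0"
    by (rule theta_base_point_free[of \<i>]) auto
  ultimately show ?thesis by (auto simp: kt_theta_def u)
qed

text \<open>The order of the two steps matters. A fixed nonzero first factor turns the proportionality
  of the products into proportionality of the second factors, which determines \<open>y\<close> and \<open>t\<close> modulo
  the integers. Only then do the first factors belong to the same \<open>\<tau> = y + \<i>\<close>, and their
  proportionality puts the difference of the two values of \<open>z + \<i> * x\<close> into the lattice of \<open>\<tau>\<close>.
  The lattice coordinates found in this way are the exponents of the group element.\<close>
lemma kt_theta_separates_points:
  assumes eq: "\<And>p q. p \<in> {1..k} \<Longrightarrow> q \<in> {1..k} \<Longrightarrow> kt_theta \<theta> p q v = c * kt_theta \<theta> p q u"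
  shows "\<exists>g\<in>kt_group. v = g u"
proof -
  obtain x y z t where u: "u = (x, y, z, t)" by (cases u)
  obtain x' y' z' t' where v: "v = (x', y', z', t')" by (cases v)
  define a where "a p = \<theta> p (of_real z + \<i> * of_real x) (of_real y + \<i>)" for p
  define a' where "a' p = \<theta> p (of_real z' + \<i> * of_real x') (of_real y' + \<i>)" for p
  define b where "b q = \<theta> q (of_real y + \<i> * of_real t) \<i>" for q
  define b' where "b' q = \<theta> q (of_real y' + \<i> * of_real t') \<i>" for q
  have prod: "a' p * b' q = c * (a p * b q)" if "p \<in> {1..k}" "q \<in> {1..k}" for p q
    using eq[OF that] by (simp add: kt_theta_def u v a_def a'_def b_def b'_def)
  obtain p0 where p0: "p0 \<in> {1..k}" "a' p0 \<noteq> 0"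
    unfolding a'_def by (rule theta_base_point_free[of "of_real y' + \<i>"]) auto
  obtain q0 where q0: "q0 \<in> {1..k}" "b' q0 \<noteq> 0"
    unfolding b'_def by (rule theta_base_point_free[of \<i>]) auto
  have "(of_real y' + \<i> * of_real t') - (of_real y + \<i> * of_real t) \<in> period_lattice \<i>"
  proof (rule theta_separates_points)
    fix q assume "q \<in> {1..k}"
    from prod[OF p0(1) this] show "\<theta> q (of_real y' + \<i> * of_real t') \<i>
        = (c * a p0 / a' p0) * \<theta> q (of_real y + \<i> * of_real t) \<i>"
      using p0(2) by (fold b_def b'_def) (simp add: field_simps)
  qed simp
  then obtain n r :: int where "(of_real y' + \<i> * of_real t') - (of_real y + \<i> * of_real t)
      = of_int n + of_int r * \<i>"
    by (auto simp: period_lattice_def)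
  then have yt: "y' = y + n" "t' = t + r"
    by (auto simp: complex_eq_iff)
  have "(of_real z' + \<i> * of_real x') - (of_real z + \<i> * of_real x) \<in> period_lattice (of_real y + \<i>)"
  proof (rule theta_separates_points)
    fix p assume p: "p \<in> {1..k}"
    have "a' p = \<theta> p (of_real z' + \<i> * of_real x') ((of_real y + \<i>) + of_int n)"
      by (simp add: a'_def yt add_ac)
    also have "\<dots> = \<theta> p (of_real z' + \<i> * of_real x') (of_real y + \<i>)"
      by (rule theta_period_modulus) (use p in auto)
    finally have "\<theta> p (of_real z' + \<i> * of_real x') (of_real y + \<i>) = a' p" by simp
    also have "a' p = (c * b q0 / b' q0) * a p"
      using prod[OF p q0(1)] q0(2) by (simp add: field_simps)
    finally show "\<theta> p (of_real z' + \<i> * of_real x') (of_real y + \<i>) =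
        (c * b q0 / b' q0) * \<theta> p (of_real z + \<i> * of_real x) (of_real y + \<i>)"
      by (simp only: a_def)
  qed simp
  then obtain l m :: int where "(of_real z' + \<i> * of_real x') - (of_real z + \<i> * of_real x)
      = of_int l + of_int m * (of_real y + \<i>)"
    by (auto simp: period_lattice_def)
  then have "z' = z + m * y + l" "x' = x + m"
    by (auto simp: complex_eq_iff)
  then have "v = kt_map m n l r u"
    by (simp add: u v kt_map_def yt)
  then show ?thesis using kt_map_in_kt_group by blast
qed

lemma theta_holomorphic2:
  assumes "p \<in> {1..k}" shows "holomorphic2_on (\<lambda>(w, \<tau>). \<theta> p w \<tau>) {(w, \<tau>). Im \<tau> > 0}"
  using fam assms by (simp add: theta_family_def)

lemma open_upper: "open {(w :: complex, \<tau>). Im \<tau> > 0}"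
proof -
  have "{(w :: complex, \<tau>). Im \<tau> > 0} = UNIV \<times> {\<tau>. Im \<tau> > 0}" by auto
  then show ?thesis by (simp add: open_Times open_halfspace_Im_gt)
qed

lemma kt_coordinates_has_derivative:
  "((\<lambda>(x, y, z, t). of_real z + \<i> * of_real x :: complex) has_derivative (\<lambda>(x, y, z, t). of_real z + \<i>
      * of_real x)) (at u)"
  "((\<lambda>(x, y, z, t). of_real y + \<i> :: complex) has_derivative (\<lambda>(x, y, z, t). of_real y)) (at (u :: r4))"
  "((\<lambda>(x, y, z, t). of_real y + \<i> * of_real t :: complex) has_derivative (\<lambda>(x, y, z, t). of_real y + \<i>
      * of_real t)) (at (u :: r4))"
  unfolding case_prod_beta by (auto intro!: derivative_eq_intros)

lemma n_times_differentiable_kt_theta: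
  assumes "p \<in> {1..k}" "q \<in> {1..k}"
  shows "n_times_differentiable_on n UNIV (kt_theta \<theta> p q)"
proof -
  have hol: "separately_holomorphic_on (\<lambda>(w, \<tau>). \<theta> p w \<tau>) {(w, \<tau>). Im \<tau> > 0}" if "p \<in> {1..k}" for p
    using holomorphic2_imp_separately_holomorphic[OF theta_holomorphic2[OF that]] .
  have "n_times_differentiable_on n UNIV (\<lambda>u :: r4. (\<lambda>(w, \<tau>). \<theta> p w \<tau>)
      ((\<lambda>(x, y, z, t). of_real z + \<i> * of_real x) u, (\<lambda>(x, y, z, t). of_real y + \<i>) u))"
    by (rule n_times_differentiable_on_separately_holomorphic[OF open_upper hol[OF assms(1)]
        kt_coordinates_has_derivative(1,2)]) (auto simp: case_prod_beta)
  moreover have "n_times_differentiable_on n UNIV (\<lambda>u :: r4. (\<lambda>(w, \<tau>). \<theta> q w \<tau>)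
      ((\<lambda>(x, y, z, t). of_real y + \<i> * of_real t) u, (\<lambda>_. \<i>) u))"
    by (rule n_times_differentiable_on_separately_holomorphic[OF open_upper hol[OF assms(2)]
        kt_coordinates_has_derivative(3) has_derivative_const]) auto
  ultimately have "n_times_differentiable_on n UNIV (\<lambda>u :: r4. (\<lambda>(w, \<tau>). \<theta> p w \<tau>)
      ((\<lambda>(x, y, z, t). of_real z + \<i> * of_real x) u, (\<lambda>(x, y, z, t). of_real y + \<i>) u)
          * (\<lambda>(w, \<tau>). \<theta> q w \<tau>)
      ((\<lambda>(x, y, z, t). of_real y + \<i> * of_real t) u, (\<lambda>_. \<i>) u))"
    by (rule n_times_differentiable_on_mult[OF open_UNIV])
  moreover have "(\<lambda>u :: r4. (\<lambda>(w, \<tau>). \<theta> p w \<tau>)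
      ((\<lambda>(x, y, z, t). of_real z + \<i> * of_real x) u, (\<lambda>(x, y, z, t). of_real y + \<i>) u)
          * (\<lambda>(w, \<tau>). \<theta> q w \<tau>)
      ((\<lambda>(x, y, z, t). of_real y + \<i> * of_real t) u, (\<lambda>_. \<i>) u)) = kt_theta \<theta> p q"
    by (auto simp: kt_theta_def fun_eq_iff)
  ultimately show ?thesis by simp
qed

text \<open>The number \<open>\<beta>\<close> is the partial derivative of the first factor in the modulus. It is left
  unnamed because it occurs only with the coefficient \<open>y'\<close>.\<close>
lemma kt_theta_has_derivative:
  assumes "p \<in> {1..k}"
  obtains \<beta> where "\<And>q. q \<in> {1..k} \<Longrightarrow> (kt_theta \<theta> p q has_derivative (\<lambda>(x', y', z', t').
      \<theta> p (of_real z + \<i> * of_real x) (of_real y + \<i>) *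
        (deriv (\<lambda>w. \<theta> q w \<i>) (of_real y + \<i> * of_real t) * (of_real y' + \<i> * of_real t')) +
      (deriv (\<lambda>w. \<theta> p w (of_real y + \<i>)) (of_real z + \<i> * of_real x) * (of_real z' + \<i> * of_real x')
          + \<beta> * of_real y') *
        \<theta> q (of_real y + \<i> * of_real t) \<i>)) (at (x, y, z, t))"
proof -
  define w where "w = of_real z + \<i> * of_real x"
  define \<tau> where "\<tau> = of_real y + \<i>"
  define v where "v = of_real y + \<i> * of_real t"
  have Im: "Im \<tau> > 0" "Im \<i> > 0" by (simp_all add: \<tau>_def)
  obtain \<alpha> \<beta> where F: "((\<lambda>(w, \<tau>). \<theta> p w \<tau>) has_derivative (\<lambda>(u, v). \<alpha> * u + \<beta> * v)) (at (w, \<tau>))"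
    using theta_holomorphic2[OF assms] Im(1) unfolding holomorphic2_on_def by blast
  have \<alpha>: "deriv (\<lambda>w. \<theta> p w \<tau>) w = \<alpha>"
    using DERIV_imp_deriv[OF holomorphic2_partials(1)[OF F]] by simp
  have F': "((\<lambda>(w, \<tau>). \<theta> p w \<tau>) has_derivative (\<lambda>(u, v). \<alpha> * u + \<beta> * v))
      (at ((\<lambda>(x, y, z, t). of_real z + \<i> * of_real x) (x, y, z, t), (\<lambda>(x, y, z, t). of_real y
          + \<i>) (x, y, z, t)))"
    using F by (simp add: w_def \<tau>_def)
  have 1: "((\<lambda>(x, y, z, t). \<theta> p (of_real z + \<i> * of_real x) (of_real y + \<i>)) has_derivative
      (\<lambda>(x', y', z', t'). \<alpha> * (of_real z' + \<i> * of_real x') + \<beta> * of_real y')) (at (x, y, z, t))"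
    using diff_chain_at[OF has_derivative_Pair[OF kt_coordinates_has_derivative(1,2)] F']
    by (simp add: o_def case_prod_unfold)
  have "(kt_theta \<theta> p q has_derivative (\<lambda>(x', y', z', t'). \<theta> p w \<tau> * (deriv (\<lambda>w. \<theta> q w \<i>) v
      * (of_real y' + \<i> * of_real t')) +
      (deriv (\<lambda>w. \<theta> p w \<tau>) w * (of_real z' + \<i> * of_real x') + \<beta> * of_real y') * \<theta> q v \<i>))
          (at (x, y, z, t))"
    if q: "q \<in> {1..k}" for q
  proof -
    have G: "((\<lambda>w. \<theta> q w \<i>) has_derivative (*) (deriv (\<lambda>w. \<theta> q w \<i>) v))
        (at ((\<lambda>(x, y, z, t). of_real y + \<i> * of_real t) (x, y, z, t)))"
      using theta_has_derivative[OF Im(2) q, of v] by (simp add: v_def has_field_derivative_def)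
    have 2: "((\<lambda>(x, y, z, t). \<theta> q (of_real y + \<i> * of_real t) \<i>) has_derivative
        (\<lambda>(x', y', z', t'). deriv (\<lambda>w. \<theta> q w \<i>) v * (of_real y' + \<i> * of_real t'))) (at (x, y, z, t))"
      using diff_chain_at[OF kt_coordinates_has_derivative(3) G] by (simp add: o_def case_prod_unfold)
    show ?thesis
      using has_derivative_mult[OF 1 2]
      by (simp add: kt_theta_def case_prod_unfold w_def \<tau>_def v_def \<alpha>[unfolded w_def \<tau>_def])
  qed
  then show thesis unfolding w_def \<tau>_def v_def by (rule that)
qed

text \<open>The infinitesimal form of the separation of points, again with the second factor first: it
  gives \<open>y' = t' = 0\<close>. This removes the derivative of the first factor in the modulus, and what
  remains is a statement about the theta functions of the fixed modulus \<open>\<tau>\<close>.\<close>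
lemma kt_theta_separates_tangents:
  assumes eq: "\<And>p q. p \<in> {1..k} \<Longrightarrow> q \<in> {1..k} \<Longrightarrow>
    \<exists>d. (kt_theta \<theta> p q has_derivative d) (at u) \<and> d v = c * kt_theta \<theta> p q u"
  shows "v = 0"
proof -
  obtain x y z t where u: "u = (x, y, z, t)" by (cases u)
  obtain x' y' z' t' where v: "v = (x', y', z', t')" by (cases v)
  define w where "w = of_real z + \<i> * of_real x"
  define \<tau> where "\<tau> = of_real y + \<i>"
  define \<zeta> where "\<zeta> = of_real y + \<i> * of_real t"
  have Im: "Im \<tau> > 0" "Im \<i> > 0" by (simp_all add: \<tau>_def)
  define a where "a p = \<theta> p w \<tau>" for p
  define b where "b q = \<theta> q \<zeta> \<i>" for q
  define A where "A p = deriv (\<lambda>w. \<theta> p w \<tau>) w * (of_real z' + \<i> * of_real x')" for p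
  define B where "B q = deriv (\<lambda>w. \<theta> q w \<i>) \<zeta> * (of_real y' + \<i> * of_real t')" for q
  have leibniz: "\<exists>\<beta>. \<forall>q\<in>{1..k}. a p * B q + (A p + \<beta> * of_real y') * b q = c * (a p * b q)"
      if p: "p \<in> {1..k}" for p
  proof -
    obtain \<beta> where \<beta>: "\<And>q. q \<in> {1..k} \<Longrightarrow> (kt_theta \<theta> p q has_derivative (\<lambda>(x', y', z', t').
        \<theta> p w \<tau> * (deriv (\<lambda>w. \<theta> q w \<i>) \<zeta> * (of_real y' + \<i> * of_real t')) +
        (deriv (\<lambda>w. \<theta> p w \<tau>) w * (of_real z' + \<i> * of_real x') + \<beta> * of_real y') * \<theta> q \<zeta> \<i>)) (at u)"
      using kt_theta_has_derivative[OF p] unfolding u w_def \<tau>_def \<zeta>_def by blast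
    show ?thesis
    proof (intro exI ballI)
      fix q assume q: "q \<in> {1..k}"
      obtain d where d: "(kt_theta \<theta> p q has_derivative d) (at u)" "d v = c * kt_theta \<theta> p q u"
        using eq[OF p q] by blast
      show "a p * B q + (A p + \<beta> * of_real y') * b q = c * (a p * b q)"
        using d(2) unfolding has_derivative_unique[OF d(1) \<beta>[OF q]]
        by (simp add: v u kt_theta_def a_def b_def A_def B_def w_def \<tau>_def \<zeta>_def)
    qed
  qed
  obtain p0 where p0: "p0 \<in> {1..k}" "a p0 \<noteq> 0"
    unfolding a_def by (rule theta_base_point_free[OF Im(1)])
  obtain q0 where q0: "q0 \<in> {1..k}" "b q0 \<noteq> 0"
    unfolding b_def by (rule theta_base_point_free[OF Im(2)])
  have "of_real y' + \<i> * of_real t' = (0 :: complex)"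
  proof -
    obtain \<beta> where \<beta>: "\<forall>q\<in>{1..k}. a p0 * B q + (A p0 + \<beta> * of_real y') * b q = c * (a p0 * b q)"
      using leibniz[OF p0(1)] by blast
    show ?thesis
    proof (rule theta_separates_tangents[OF Im(2), where w = \<zeta>])
      fix q assume "q \<in> {1..k}"
      then have "B q = (c - (A p0 + \<beta> * of_real y') / a p0) * b q"
        using \<beta> p0(2) by (simp add: field_simps)
      then show "deriv (\<lambda>w. \<theta> q w \<i>) \<zeta> * (of_real y' + \<i> * of_real t') = (c - (A p0 + \<beta> * of_real y')
          / a p0) * \<theta> q \<zeta> \<i>"
        by (simp only: B_def b_def)
    qed
  qed
  then have yt: "y' = 0" "t' = 0" by (auto simp: complex_eq_iff)
  then have B: "B q = 0" for q by (simp add: B_def)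
  have "of_real z' + \<i> * of_real x' = (0 :: complex)"
  proof (rule theta_separates_tangents[OF Im(1), where w = w])
    fix p assume p: "p \<in> {1..k}"
    have "A p * b q0 = (c * a p) * b q0"
      using leibniz[OF p] q0(1) B yt by auto
    then have "A p = c * a p" using q0(2) by simp
    then show "deriv (\<lambda>w. \<theta> p w \<tau>) w * (of_real z' + \<i> * of_real x') = c * \<theta> p w \<tau>"
      by (simp only: A_def a_def)
  qed
  then have "z' = 0" "x' = 0" by (auto simp: complex_eq_iff)
  with yt show ?thesis by (simp add: v zero_prod_def)
qed

end

theorem theorem1:
  fixes k :: nat
    and \<theta> :: "nat \<Rightarrow> complex \<Rightarrow> complex \<Rightarrow> complex"
    and s :: "'m::finite option \<Rightarrow> r4 \<Rightarrow> complex"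
  assumes "k \<ge> 3"
    and "CARD('m) = k\<^sup>2 - 1"
    and "theta_family k \<theta>"
    and "is_basis UNIV s (kt_theta_space k \<theta>)"
  shows "\<exists>\<phi> :: r4 set \<Rightarrow> (complex ^ 'm option) set.
    (\<forall>u. \<phi> (kt_proj u) = cp_point (\<chi> i. s i u)) \<and>
    smooth_embedding kt_top kt_atlas cp_top cp_atlas \<phi>"
proof (rule smooth_embedding_by_sections)
  note fam = assms(1,3)
  \<comment> \<open>Linear conditions pass from the products to the given basis, and back.\<close>
  have sections: "s i \<in> T"
    if "cfun.subspace T" "\<And>p q. p \<in> {1..k} \<Longrightarrow> q \<in> {1..k} \<Longrightarrow> kt_theta \<theta> p q \<in> T" for T i
  proof -
    have "kt_theta_space k \<theta> \<subseteq> T"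
      unfolding kt_theta_space_def using that by (intro cfun.span_minimal) auto
    then show ?thesis using is_basis_mem[OF assms(4)] by blast
  qed
  have products: "kt_theta \<theta> p q \<in> T"
    if "cfun.subspace T" "\<And>i. s i \<in> T" "p \<in> {1..k}" "q \<in> {1..k}" for T p q
  proof -
    have "kt_theta \<theta> p q \<in> kt_theta_space k \<theta>"
      unfolding kt_theta_space_def using that(3,4) by (intro cfun.span_base) blast
    then show ?thesis using is_basis_subset_subspace[OF assms(4) that(1,2)] by blast
  qed
  show smooth: "n_times_differentiable_on n UNIV (s i)" for n i
    using sections[OF subspace_n_times_differentiable, of n i] n_times_differentiable_kt_theta[OF fam]
        by blast
  show "\<exists>i. s i u \<noteq> 0" for u
  proof (rule ccontr)
    assume "\<not> (\<exists>i. s i u \<noteq> 0)"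
    then have "kt_theta \<theta> p q u = 0" if "p \<in> {1..k}" "q \<in> {1..k}" for p q
      using products[OF subspace_proportional[of u 0 u] _ that] by simp
    then show False using kt_theta_base_point_free[OF fam, of u] by blast
  qed
  show "\<exists>c. c \<noteq> 0 \<and> (\<forall>i. s i (g u) = c * s i u)" if g: "g \<in> kt_group" for g u
  proof -
    obtain m n l r where "g = kt_map m n l r" using kt_group_imp_kt_map[OF g] by blast
    then obtain c where c: "c \<noteq> 0" "\<forall>p\<in>{1..k}. \<forall>q\<in>{1..k}. kt_theta \<theta> p q (g u) = c * kt_theta \<theta> p q u"
      using kt_theta_multiplier[OF fam] by blast
    have "s i (g u) = c * s i u" for i
      using sections[OF subspace_proportional[of "g u" c u], of i] c(2) by blast
    then show ?thesis using c(1) by blast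
  qed
  show "\<exists>g\<in>kt_group. v = g u" if eq: "\<forall>i. s i v = c * s i u" for u v c
  proof (rule kt_theta_separates_points[OF fam])
    fix p q assume "p \<in> {1..k}" "q \<in> {1..k}"
    then show "kt_theta \<theta> p q v = c * kt_theta \<theta> p q u"
      using products[OF subspace_proportional[of v c u]] eq by blast
  qed
  show "v = 0" if eq: "\<forall>i. frechet_derivative (s i) (at u) v = c * s i u" for u v c
  proof (rule kt_theta_separates_tangents[OF fam])
    fix p q assume pq: "p \<in> {1..k}" "q \<in> {1..k}"
    have "s i \<in> {f. \<exists>d. (f has_derivative d) (at u) \<and> d v = c * f u}" for i
    proof -
      have "(s i has_derivative frechet_derivative (s i) (at u)) (at u)"
        using smooth[of "Suc 0" i] unfolding n_times_differentiable_on.simps(2)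
            frechet_derivative_works by blast
      then show ?thesis using eq by blast
    qed
    from products[OF subspace_proportional_derivative this pq]
    show "\<exists>d. (kt_theta \<theta> p q has_derivative d) (at u) \<and> d v = c * kt_theta \<theta> p q u" by blast
  qed
qed

end
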